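(* Let $\Theta$ be a word rewriting system over $\Delta=\{0,1\}$ and let $w\in\Delta^*$. Then the core chase sequence $I_w=I_0,I_1,I_2,\dots$ with $\Sigma_\Theta$ on $I_w$ is infinite if and only if there is an infinite derivation $w=w_0,w_1,w_2,\dots$ generated by $\Theta$.
   Context: Word rewriting: $\Theta$ is a finite subset of $\Delta^*\times\Delta^*$ (its elements are rules, with nonempty left-hand sides). Write $u\to v$ if $u=x\ell y$, $v=xry$ for some $x,y\in\Delta^*$ and $(\ell,r)\in\Theta$. A derivation generated by $\Theta$ is a finite or infinite sequence $w_0,w_1,\dots$ of words with $w_i\to w_{i+1}$ for all $i$. Chase: Let $\mathsf{Cons}$ (constants, containing $0,1$), $\mathsf{Nulls}$ and $\mathsf{Vars}$ be pairwise disjoint countably infinite sets. An instance is a finite set of atoms with arguments in $\mathsf{Cons}\cup\mathsf{Nulls}$. A homomorphism between instances is the identity on constants and maps atoms to atoms; an endomorphism of $I$ is a homomorphism from $I$ to $I$. A core of $I$ is a subset $I'\subseteq I$ such that some endomorphism $h$ has $h(I)\subseteq I'$ and no endomorphism $g$ has $g(I')\subsetneq I'$ (unique up to isomorphism). A tgd is a sentence $\forall\bar x,\bar y\,(\alpha(\bar x,\bar y)\to\exists\bar z\,\beta(\bar x,\bar z))$ with $\alpha,\beta$ conjunctions of atoms over variables and constants ($\alpha$ may be empty). A trigger $(\xi,h)$ on $I$ consists of a tgd $\xi=\alpha\to\beta$ and a mapping $h$ of its universal variables with $h(\alpha)\subseteq I$; it is active if no extension $h'$ of $h$ has $h'(\beta)\subseteq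 I$. Firing it yields $I\cup h'(\beta)$, where $h'$ extends $h$ by assigning new fresh nulls to the existential variables. In the core chase sequence, $I_{i+1}$ is obtained from $I_i$ by firing all triggers active on $I_i$ in parallel and taking the core of the union of the results; the sequence is finite (terminates) if some $I_i$ has no active trigger, and infinite otherwise. The set $\Sigma_\Theta$ over the schema $\{E,E^*,L,R,D\}$ (arities $3,2,2,2,1$) consists of the following tgds. - For each rule $\rho=(a_1\dots a_n,\,b_1\dots b_m)\in\Theta$: $E(x_0,a_1,x_1),\dots,E(x_{n-1},a_n,x_n)\to\exists y_0,\dots,y_m\; L(x_0,y_0),E(y_0,b_1,y_1),\dots,E(y_{m-1},b_m,y_m),R(x_n,y_m)$. - For each $c\in\{0,1\}$: $E(x_0,c,x_1),L(x_1,y_1)\to\exists y_0\;L(x_0,y_0),E(y_0,c,y_1)$ and $R(x_0,z_0),E(x_0,c,x_1)\to\exists z_1\;E(z_0,c,z_1),R(x_1,z_1)$. - $\to D(0),D(1)$; $E(x,z,y)\to D(x),D(z),D(y)$; $L(x,y)\to D(x),D(y)$; $R(x,y)\to D(x),D(y)$; $E^*(x,y)\to D(x),D(y)$. - $E(x,z,y)\to E^*(x,y)$; $L(x,y)\to E^*(x,y)$; $R(x,y)\to E^*(x,y)$; $E^*(x,y),E^*(y,z)\to E^*(x,z)$. - $E^*(v,v),D(x),D(z),D(y)\to E(x,z,y)$; $E^*(v,v),D(x),D(y)\to L(x,y),R(x,y),E^*(x,y)$. For $w=a_1a_2\dots a_n\in\Delta^*$, $I_w=\{E(x_0,a_1,x_1),E(x_1,a_2,x_2),\dots,E(x_{n-1},a_n,x_n)\}$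 with $x_0,\dots,x_n$ pairwise distinct nulls. *)

theory Defs
  imports Main
begin

section \<open>Word rewriting\<close>

datatype letter = Zero | One

type_synonym word = "letter list"

definition word_rewriting_system :: "(word \<times> word) set \<Rightarrow> bool" where
  "word_rewriting_system \<Theta> \<longleftrightarrow> finite \<Theta> \<and> (\<forall>(l, r) \<in> \<Theta>. l \<noteq> [])"

definition rewrite_step :: "(word \<times> word) set \<Rightarrow> word \<Rightarrow> word \<Rightarrow> bool" where
  "rewrite_step \<Theta> u v \<longleftrightarrow> (\<exists>x y l r. (l, r) \<in> \<Theta> \<and> u = x @ l @ y \<and> v = x @ r @ y)"

definition infinite_derivation :: "(word \<times> word) set \<Rightarrow> (nat \<Rightarrow> word) \<Rightarrow> bool" where
  "infinite_derivation \<Theta> ws \<longleftrightarrow> (\<forall>i. rewrite_step \<Theta> (ws i) (ws (Suc i)))"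

section \<open>Instances, homomorphisms and cores\<close>

datatype val = Const nat | Null nat

datatype trm = Con nat | Var nat

text \<open>The schema is built into the type of atoms, so that arities are always respected;
  \<open>Estar\<close> is the relation symbol \<open>E\<^sup>*\<close>.\<close>

datatype 'a atom = E 'a 'a 'a | Estar 'a 'a | L 'a 'a | R 'a 'a | D 'a

definition adom :: "val atom set \<Rightarrow> val set" where
  "adom I = (\<Union>A\<in>I. set_atom A)"

definition homomorphism :: "val atom set \<Rightarrow> val atom set \<Rightarrow> (val \<Rightarrow> val) \<Rightarrow> bool" where
  "homomorphism I J h \<longleftrightarrow> (\<forall>c. h (Const c) = Const c) \<and> map_atom h ` I \<subseteq> J"

abbreviation endomorphism :: "val atom set \<Rightarrow> (val \<Rightarrow> val) \<Rightarrow> bool" where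
  "endomorphism I h \<equiv> homomorphism I I h"

definition is_core :: "val atom set \<Rightarrow> val atom set \<Rightarrow> bool" where
  "is_core I I' \<longleftrightarrow> I' \<subseteq> I
     \<and> (\<exists>h. endomorphism I h \<and> map_atom h ` I \<subseteq> I')
     \<and> \<not> (\<exists>g. endomorphism I g \<and> map_atom g ` I' \<subset> I')"

section \<open>Tuple-generating dependencies and the core chase\<close>

datatype tgd = TGD (body: "trm atom list") (head: "trm atom list")  (infix "\<leadsto>" 50)

definition vars :: "trm atom list \<Rightarrow> nat set" where
  "vars As = {v. \<exists>A \<in> set As. Var v \<in> set_atom A}"

definition univ_vars :: "tgd \<Rightarrow> nat set" where
  "univ_vars \<xi> = vars (body \<xi>)"

definition ex_vars :: "tgd \<Rightarrow> nat set" where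
  "ex_vars \<xi> = vars (head \<xi>) - vars (body \<xi>)"

fun trm_val :: "(nat \<rightharpoonup> val) \<Rightarrow> trm \<Rightarrow> val" where
  "trm_val h (Con c) = Const c"
| "trm_val h (Var v) = the (h v)"

definition inst :: "(nat \<rightharpoonup> val) \<Rightarrow> trm atom list \<Rightarrow> val atom set" where
  "inst h As = map_atom (trm_val h) ` set As"

text \<open>Assignments are partial maps with the exact domain prescribed, so that each assignment of the
  universal variables gives rise to one trigger only.\<close>

type_synonym trigger = "tgd \<times> (nat \<rightharpoonup> val)"

definition triggers :: "tgd set \<Rightarrow> val atom set \<Rightarrow> trigger set" where
  "triggers \<Sigma> I = {(\<xi>, h). \<xi> \<in> \<Sigma> \<and> dom h = univ_vars \<xi> \<and> inst h (body \<xi>) \<subseteq> I}"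

definition active_triggers :: "tgd set \<Rightarrow> val atom set \<Rightarrow> trigger set" where
  "active_triggers \<Sigma> I = {(\<xi>, h) \<in> triggers \<Sigma> I.
     \<not> (\<exists>h'. h \<subseteq>\<^sub>m h' \<and> dom h' = univ_vars \<xi> \<union> ex_vars \<xi> \<and> inst h' (head \<xi>) \<subseteq> I)}"

definition fire :: "val atom set \<Rightarrow> trigger \<Rightarrow> (nat \<Rightarrow> nat) \<Rightarrow> val atom set" where
  "fire I t \<nu> = (case t of (\<xi>, h) \<Rightarrow>
     I \<union> inst (\<lambda>v. if v \<in> ex_vars \<xi> then Some (Null (\<nu> v)) else h v) (head \<xi>))"

text \<open>\<open>\<nu> t z\<close> is the null chosen for the existential variable \<open>z\<close> when firing \<open>t\<close>. Distinct pairs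
  \<open>(t, z)\<close> get distinct nulls.\<close>

definition parallel_firing :: "tgd set \<Rightarrow> val atom set \<Rightarrow> val atom set \<Rightarrow> bool" where
  "parallel_firing \<Sigma> I J \<longleftrightarrow>
     (\<exists>\<nu>. inj_on (\<lambda>(t, z). \<nu> t z) (SIGMA t:active_triggers \<Sigma> I. ex_vars (fst t))
        \<and> (\<forall>t \<in> active_triggers \<Sigma> I. \<forall>z \<in> ex_vars (fst t). Null (\<nu> t z) \<notin> adom I)
        \<and> J = (\<Union>t \<in> active_triggers \<Sigma> I. fire I t (\<nu> t)))"

definition core_chase_step :: "tgd set \<Rightarrow> val atom set \<Rightarrow> val atom set \<Rightarrow> bool" where
  "core_chase_step \<Sigma> I I' \<longleftrightarrow> (\<exists>J. parallel_firing \<Sigma> I J \<and> is_core J I')"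

text \<open>Chase sequences are unique only up to the choice of nulls and cores, hence a predicate; existence
  is shown below. A finite sequence is represented by repeating its last instance forever.\<close>

definition core_chase_sequence ::
    "tgd set \<Rightarrow> val atom set \<Rightarrow> (nat \<Rightarrow> val atom set) \<Rightarrow> bool" where
  "core_chase_sequence \<Sigma> I\<^sub>0 Is \<longleftrightarrow> Is 0 = I\<^sub>0
     \<and> (\<forall>i. if active_triggers \<Sigma> (Is i) = {} then Is (Suc i) = Is i
            else core_chase_step \<Sigma> (Is i) (Is (Suc i)))"

definition chase_terminates :: "tgd set \<Rightarrow> (nat \<Rightarrow> val atom set) \<Rightarrow> bool" where
  "chase_terminates \<Sigma> Is \<longleftrightarrow> (\<exists>i. active_triggers \<Sigma> (Is i) = {})"

abbreviation chase_infinite :: "tgd set \<Rightarrow> (nat \<Rightarrow> val atom set) \<Rightarrow> bool" where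
  "chase_infinite \<Sigma> Is \<equiv> \<not> chase_terminates \<Sigma> Is"

section \<open>Existence of core chase sequences\<close>

lemma homomorphism_comp:
  assumes "homomorphism I J h" "homomorphism J K g"
  shows "homomorphism I K (g \<circ> h)"
  using assms by (force simp: homomorphism_def atom.map_comp[symmetric])

lemma core_exists:
  assumes "finite I"
  shows "\<exists>I'. is_core I I'"
proof -
  have id: "endomorphism I id"
    by (simp add: homomorphism_def atom.map_id0)
  define h where "h = arg_min (\<lambda>h. card (map_atom h ` I)) (endomorphism I)"
  have h: "endomorphism I h"
    unfolding h_def by (rule arg_min_natI[where P = "endomorphism I", OF id])
  have least: "card (map_atom h ` I) \<le> card (map_atom g ` I)" if "endomorphism I g" for g
    unfolding h_def by (rule arg_min_nat_le[where P = "endomorphism I", OF that])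
  have "\<not> map_atom g ` (map_atom h ` I) \<subset> map_atom h ` I" if g: "endomorphism I g" for g
  proof
    assume "map_atom g ` (map_atom h ` I) \<subset> map_atom h ` I"
    then have "card (map_atom g ` (map_atom h ` I)) < card (map_atom h ` I)"
      using assms by (intro psubset_card_mono) auto
    moreover have "map_atom g ` (map_atom h ` I) = map_atom (g \<circ> h) ` I"
      by (simp add: image_image atom.map_comp)
    ultimately show False
      using least[OF homomorphism_comp[OF h g]] by simp
  qed
  moreover have "map_atom h ` I \<subseteq> I"
    using h by (simp add: homomorphism_def)
  ultimately have "is_core I (map_atom h ` I)"
    unfolding is_core_def using h by blast
  then show ?thesis ..
qed

lemma finite_vars: "finite (vars As)"
proof -
  have "finite (set_atom A)" for A :: "trm atom"
    by (cases A) auto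
  then have "finite (Var -` (\<Union>A\<in>set As. set_atom A))"
    by (intro finite_vimageI) (auto intro: injI)
  then show ?thesis
    by (rule finite_subset[rotated]) (auto simp: vars_def)
qed

lemma finite_adom: "finite I \<Longrightarrow> finite (adom I)"
proof -
  have "finite (set_atom A)" for A :: "val atom"
    by (cases A) auto
  then show "finite I \<Longrightarrow> finite (adom I)"
    by (simp add: adom_def)
qed

lemma finite_active_triggers:
  assumes "finite \<Sigma>" "finite I"
  shows "finite (active_triggers \<Sigma> I)"
proof -
  have ran: "ran h \<subseteq> adom I" if "dom h = univ_vars \<xi>" "inst h (body \<xi>) \<subseteq> I" for \<xi> h
  proof
    fix a assume "a \<in> ran h"
    then obtain v where v: "h v = Some a" by (auto simp: ran_def)
    then have "v \<in> univ_vars \<xi>" using that(1) by auto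
    then obtain A where A: "A \<in> set (body \<xi>)" "Var v \<in> set_atom A"
      by (auto simp: univ_vars_def vars_def)
    then have "trm_val h (Var v) \<in> set_atom (map_atom (trm_val h) A)"
      by (simp only: atom.set_map imageI)
    moreover have "map_atom (trm_val h) A \<in> I"
      using A that(2) by (auto simp: inst_def)
    ultimately show "a \<in> adom I"
      using v by (auto simp: adom_def)
  qed
  have "active_triggers \<Sigma> I
      \<subseteq> (SIGMA \<xi>:\<Sigma>. {h. dom h = univ_vars \<xi> \<and> ran h \<subseteq> adom I})"
    using ran by (auto simp: active_triggers_def triggers_def)
  moreover have "finite (SIGMA \<xi>:\<Sigma>. {h. dom h = univ_vars \<xi> \<and> ran h \<subseteq> adom I})"
    using assms by (intro finite_SigmaI finite_set_of_finite_maps)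
      (auto simp: univ_vars_def finite_vars finite_adom)
  ultimately show ?thesis by (rule finite_subset)
qed

lemma core_chase_step_exists:
  assumes "finite \<Sigma>" "finite I"
  shows "\<exists>I'. core_chase_step \<Sigma> I I' \<and> finite I'"
proof -
  let ?T = "active_triggers \<Sigma> I"
  let ?S = "SIGMA t:?T. ex_vars (fst t)"
  let ?N = "- (Null -` adom I)"
  have finS: "finite ?S"
    using assms by (intro finite_SigmaI finite_active_triggers)
      (auto simp: ex_vars_def finite_vars)
  have "finite (Null -` adom I)"
    using assms by (intro finite_vimageI finite_adom) (auto intro: injI)
  then have "infinite ?N"
    by (metis Compl_eq_Diff_UNIV Diff_infinite_finite infinite_UNIV_nat)
  from infinite_arbitrarily_large[OF this, of "card ?S"]
  obtain B where B: "finite B" "card B = card ?S" "B \<subseteq> ?N"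
    by blast
  obtain f where f: "bij_betw f ?S B"
    using finite_same_card_bij[OF finS B(1) B(2)[symmetric]] by blast
  define \<nu> where "\<nu> t z = f (t, z)" for t z
  define J where "J = (\<Union>t \<in> ?T. fire I t (\<nu> t))"
  have "inj_on (\<lambda>(t, z). \<nu> t z) ?S"
    using f by (simp add: \<nu>_def bij_betw_def)
  moreover have "Null (\<nu> t z) \<notin> adom I" if "t \<in> ?T" "z \<in> ex_vars (fst t)" for t z
  proof -
    have "f (t, z) \<in> B"
      using bij_betwE[OF f] that by (auto simp del: split_paired_All)
    then show ?thesis using B by (auto simp: \<nu>_def)
  qed
  ultimately have "parallel_firing \<Sigma> I J"
    unfolding parallel_firing_def J_def by blast
  moreover have "finite J"
    using assms by (auto simp: J_def fire_def inst_def finite_active_triggers split: prod.split)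
  moreover from this obtain I' where "is_core J I'"
    using core_exists by blast
  ultimately show ?thesis
    by (auto simp: core_chase_step_def is_core_def intro: finite_subset)
qed

lemma core_chase_sequence_exists:
  assumes "finite \<Sigma>" "finite I\<^sub>0"
  shows "\<exists>Is. core_chase_sequence \<Sigma> I\<^sub>0 Is"
proof -
  have "\<exists>Is. \<forall>i. (finite (Is i) \<and> (i = 0 \<longrightarrow> Is i = I\<^sub>0)) \<and>
      (if active_triggers \<Sigma> (Is i) = {} then Is (Suc i) = Is i
       else core_chase_step \<Sigma> (Is i) (Is (Suc i)))"
  proof (rule dependent_nat_choice)
    show "\<exists>I. finite I \<and> (0 = (0::nat) \<longrightarrow> I = I\<^sub>0)"
      using assms by blast
  next
    fix I and i :: nat
    assume "finite I \<and> (i = 0 \<longrightarrow> I = I\<^sub>0)"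
    then show "\<exists>I'. (finite I' \<and> (Suc i = 0 \<longrightarrow> I' = I\<^sub>0)) \<and>
        (if active_triggers \<Sigma> I = {} then I' = I else core_chase_step \<Sigma> I I')"
      using core_chase_step_exists[OF assms(1), of I] by (cases "active_triggers \<Sigma> I = {}") auto
  qed
  then show ?thesis
    unfolding core_chase_sequence_def by blast
qed

section \<open>The tgds associated with a word rewriting system\<close>

fun letter_code :: "letter \<Rightarrow> nat" where
  "letter_code Zero = 0"
| "letter_code One = 1"

definition path :: "(nat \<Rightarrow> 'a) \<Rightarrow> (nat \<Rightarrow> 'a) \<Rightarrow> word \<Rightarrow> 'a atom list" where
  "path const x w =
     map (\<lambda>i. E (x i) (const (letter_code (w ! i))) (x (Suc i))) [0..<length w]"

text \<open>In the tgd of a rule, \<open>x\<^sub>i\<close> is variable \<open>i\<close> for \<open>i \<le> n\<close>, and \<open>y\<^sub>j\<close> is variable \<open>n + 1 + j\<close>.\<close>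

definition rule_tgd :: "word \<times> word \<Rightarrow> tgd" where
  "rule_tgd \<rho> = (case \<rho> of (l, r) \<Rightarrow>
     let n = length l; m = length r; x = Var; y = (\<lambda>j. Var (n + 1 + j)) in
       path Con x l \<leadsto> [L (x 0) (y 0)] @ path Con y r @ [R (x n) (y m)])"

definition context_tgds :: "tgd set" where
  "context_tgds = (\<Union>c \<in> {0, 1}.
     let x0 = Var 0; x1 = Var 1; y0 = Var 2; y1 = Var 3 in
       {[E x0 (Con c) x1, L x1 y1] \<leadsto> [L x0 y0, E y0 (Con c) y1],
        [R x0 y0, E x0 (Con c) x1] \<leadsto> [E y0 (Con c) y1, R x1 y1]})"

definition domain_tgds :: "tgd set" where
  "domain_tgds = (let x = Var 0; y = Var 1; z = Var 2 in
     {[] \<leadsto> [D (Con 0), D (Con 1)],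
      [E x z y] \<leadsto> [D x, D z, D y],
      [L x y] \<leadsto> [D x, D y],
      [R x y] \<leadsto> [D x, D y],
      [Estar x y] \<leadsto> [D x, D y]})"

definition closure_tgds :: "tgd set" where
  "closure_tgds = (let x = Var 0; y = Var 1; z = Var 2 in
     {[E x z y] \<leadsto> [Estar x y],
      [L x y] \<leadsto> [Estar x y],
      [R x y] \<leadsto> [Estar x y],
      [Estar x y, Estar y z] \<leadsto> [Estar x z]})"

definition loop_tgds :: "tgd set" where
  "loop_tgds = (let x = Var 0; y = Var 1; z = Var 2; v = Var 3 in
     {[Estar v v, D x, D z, D y] \<leadsto> [E x z y],
      [Estar v v, D x, D y] \<leadsto> [L x y, R x y, Estar x y]})"

definition \<Sigma>_of :: "(word \<times> word) set \<Rightarrow> tgd set" where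
  "\<Sigma>_of \<Theta> = rule_tgd ` \<Theta> \<union> context_tgds \<union> domain_tgds \<union> closure_tgds \<union> loop_tgds"

definition word_instance :: "(nat \<Rightarrow> nat) \<Rightarrow> word \<Rightarrow> val atom set" where
  "word_instance x w = set (path Const (\<lambda>i. Null (x i)) w)"

lemma core_chase_sequence_word_instance_exists:
  assumes "word_rewriting_system \<Theta>"
  shows "\<exists>Is. core_chase_sequence (\<Sigma>_of \<Theta>) (word_instance x w) Is"
  using assms
  by (intro core_chase_sequence_exists)
    (auto simp: word_rewriting_system_def \<Sigma>_of_def context_tgds_def domain_tgds_def
      closure_tgds_def loop_tgds_def word_instance_def Let_def)

end

(* Every tgd of the chase can be read over an arbitrary carrier, and the core chase maps into every
   model. If there is an infinite derivation, then every model of Sigma_Theta that receives I_w contains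
   an infinite L-path, so a finite one contains an atom E*(v,v); but the chase maps into an infinite
   model without such atoms, so no stage of it can be a model. Conversely, if there is no infinite
   derivation, then by Koenig's lemma the tree of all derivations from w is finite. Each of its nodes
   carries a path labelled by the word derived there, and the resulting finite model maps into every
   model that receives I_w, in particular into the limit of an infinite chase, hence into some stage.
   That stage maps back into the tree model and is a core, so it is itself a model. *)

theory Submission
  imports Defs
begin

section \<open>Satisfaction of tgds over an arbitrary carrier\<close>

text \<open>Taking cores folds a stage onto part of itself, so successive stages are related by
  homomorphisms and not by inclusion. The limit is therefore formed along these homomorphisms, and
  it need not be finite. Finiteness of the tree brings the argument back to a stage: a map from a
  finite structure uses only finitely many atoms of the limit. Being homomorphically equivalent to a
  model does not make a structure a model in general; for a finite core it does, since the round
  trip through the model is an automorphism. The tree keeps separate copies even of the letters that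
  a step leaves unchanged: \<open>L x x\<close> would produce \<open>Estar x x\<close>, and then the
  loop tgds add every atom over the domain. It also separates equal words reached by different
  derivations, since merging them could destroy the map into models that keep them apart. In the
  grid and in the tree the loop tgds hold vacuously, as neither has an atom
  \<open>Estar v v\<close>.\<close>

fun trm_eval :: "(nat \<Rightarrow> 'a) \<Rightarrow> (nat \<Rightarrow> 'a) \<Rightarrow> trm \<Rightarrow> 'a" where
  "trm_eval \<kappa> h (Con c) = \<kappa> c"
| "trm_eval \<kappa> h (Var v) = h v"

text \<open>Assignments are total here, whereas triggers use partial maps; agreement is demanded on
  the body variables only. Constants are read through \<open>\<kappa>\<close>, which need not be
  injective: the grid sends all of them to one element.\<close>

definition satisfies :: "(nat \<Rightarrow> 'a) \<Rightarrow> 'a atom set \<Rightarrow> tgd \<Rightarrow> bool" where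
  "satisfies \<kappa> M \<xi> \<longleftrightarrow> (\<forall>h. map_atom (trm_eval \<kappa> h) ` set (body \<xi>) \<subseteq> M \<longrightarrow>
     (\<exists>h'. (\<forall>v \<in> vars (body \<xi>). h' v = h v) \<and> map_atom (trm_eval \<kappa> h') ` set (head \<xi>) \<subseteq> M))"

section \<open>Closure conditions equivalent to the tgds\<close>

definition is_path :: "(nat \<Rightarrow> 'a) \<Rightarrow> 'a atom set \<Rightarrow> word \<Rightarrow> (nat \<Rightarrow> 'a) \<Rightarrow> bool" where
  "is_path \<kappa> M w p \<longleftrightarrow> (\<forall>i < length w. E (p i) (\<kappa> (letter_code (w ! i))) (p (Suc i)) \<in> M)"

definition rule_closed :: "(nat \<Rightarrow> 'a) \<Rightarrow> (word \<times> word) set \<Rightarrow> 'a atom set \<Rightarrow> bool" where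
  "rule_closed \<kappa> \<Theta> M \<longleftrightarrow> (\<forall>(l, r) \<in> \<Theta>. \<forall>p. is_path \<kappa> M l p \<longrightarrow>
     (\<exists>q. is_path \<kappa> M r q \<and> L (p 0) (q 0) \<in> M \<and> R (p (length l)) (q (length r)) \<in> M))"

definition context_closed :: "(nat \<Rightarrow> 'a) \<Rightarrow> 'a atom set \<Rightarrow> bool" where
  "context_closed \<kappa> M \<longleftrightarrow>
     (\<forall>a x0 x1 y1. E x0 (\<kappa> (letter_code a)) x1 \<in> M \<longrightarrow> L x1 y1 \<in> M \<longrightarrow>
        (\<exists>y0. L x0 y0 \<in> M \<and> E y0 (\<kappa> (letter_code a)) y1 \<in> M)) \<and>
     (\<forall>a x0 x1 y0. R x0 y0 \<in> M \<longrightarrow> E x0 (\<kappa> (letter_code a)) x1 \<in> M \<longrightarrow>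
        (\<exists>y1. E y0 (\<kappa> (letter_code a)) y1 \<in> M \<and> R x1 y1 \<in> M))"

definition domain_closed :: "(nat \<Rightarrow> 'a) \<Rightarrow> 'a atom set \<Rightarrow> bool" where
  "domain_closed \<kappa> M \<longleftrightarrow> D (\<kappa> 0) \<in> M \<and> D (\<kappa> 1) \<in> M \<and>
     (\<forall>x y z. E x z y \<in> M \<longrightarrow> D x \<in> M \<and> D z \<in> M \<and> D y \<in> M) \<and>
     (\<forall>x y. L x y \<in> M \<or> R x y \<in> M \<or> Estar x y \<in> M \<longrightarrow> D x \<in> M \<and> D y \<in> M)"

definition star_closed :: "'a atom set \<Rightarrow> bool" where
  "star_closed M \<longleftrightarrow>
     (\<forall>x y z. E x z y \<in> M \<longrightarrow> Estar x y \<in> M) \<and>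
     (\<forall>x y. L x y \<in> M \<or> R x y \<in> M \<longrightarrow> Estar x y \<in> M) \<and>
     (\<forall>x y z. Estar x y \<in> M \<longrightarrow> Estar y z \<in> M \<longrightarrow> Estar x z \<in> M)"

text \<open>A nonempty \<open>l\<close> makes all of \<open>0, ..., length l\<close> body variables,
  so the ends of the path are universal. For an empty \<open>l\<close> the body has no variables,
  and the starting point would become existential.\<close>

lemma satisfies_rule_tgd:
  assumes "l \<noteq> []"
  shows "satisfies \<kappa> M (rule_tgd (l, r)) \<longleftrightarrow> rule_closed \<kappa> {(l, r)} M"
proof -
  let ?n = "length l" and ?m = "length r"
  have body: "body (rule_tgd (l, r)) = path Con Var l"
    by (simp add: rule_tgd_def Let_def)
  have head: "map_atom (trm_eval \<kappa> h) ` set (head (rule_tgd (l, r))) \<subseteq> M \<longleftrightarrow>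
      is_path \<kappa> M r (\<lambda>j. h (?n + 1 + j)) \<and> L (h 0) (h (?n + 1)) \<in> M \<and> R (h ?n) (h (?n + 1 + ?m)) \<in> M"
    for h
    by (auto simp: rule_tgd_def Let_def path_def is_path_def image_subset_iff)
  have path: "map_atom (trm_eval \<kappa> h) ` set (path Con Var l) \<subseteq> M \<longleftrightarrow> is_path \<kappa> M l h" for h
    by (auto simp: path_def is_path_def image_subset_iff)
  have "v \<in> vars (path Con Var l) \<longleftrightarrow> (\<exists>i < ?n. v = i \<or> v = Suc i)" for v
    by (auto simp: vars_def path_def)
  moreover have "(\<exists>i < ?n. v = i \<or> v = Suc i) \<longleftrightarrow> v \<le> ?n" for v
    using assms by (cases v) (auto simp: Suc_le_eq)
  ultimately have vars: "vars (path Con Var l) = {..?n}"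
    by auto
  show ?thesis
  proof
    assume sat: "satisfies \<kappa> M (rule_tgd (l, r))"
    have "\<exists>q. is_path \<kappa> M r q \<and> L (p 0) (q 0) \<in> M \<and> R (p ?n) (q ?m) \<in> M" if p: "is_path \<kappa> M l p" for p
    proof -
      obtain h where "(\<forall>v \<in> {..?n}. h v = p v) \<and> is_path \<kappa> M r (\<lambda>j. h (?n + 1 + j)) \<and>
          L (h 0) (h (?n + 1)) \<in> M \<and> R (h ?n) (h (?n + 1 + ?m)) \<in> M"
        using sat[unfolded satisfies_def head body path vars, rule_format, OF p] ..
      then show ?thesis
        by (intro exI[of _ "\<lambda>j. h (?n + 1 + j)"]) auto
    qed
    then show "rule_closed \<kappa> {(l, r)} M"
      by (simp add: rule_closed_def)
  next
    assume closed: "rule_closed \<kappa> {(l, r)} M"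
    show "satisfies \<kappa> M (rule_tgd (l, r))"
      unfolding satisfies_def head body path vars
    proof (intro allI impI)
      fix p assume "is_path \<kappa> M l p"
      then obtain q where "is_path \<kappa> M r q" "L (p 0) (q 0) \<in> M" "R (p ?n) (q ?m) \<in> M"
        using closed by (auto simp: rule_closed_def)
      then show "\<exists>h'. (\<forall>v\<in>{..?n}. h' v = p v) \<and> is_path \<kappa> M r (\<lambda>j. h' (?n + 1 + j)) \<and>
          L (h' 0) (h' (?n + 1)) \<in> M \<and> R (h' ?n) (h' (?n + 1 + ?m)) \<in> M"
        by (intro exI[of _ "\<lambda>v. if v \<le> ?n then p v else q (v - Suc ?n)"]) (auto simp: is_path_def)
    qed
  qed
qed

text \<open>Indexing by letters instead of the codes 0 and 1 matches the labels that occur in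
  paths.\<close>

lemma context_tgds_alt:
  "context_tgds = (\<Union>a.
     {[E (Var 0) (Con (letter_code a)) (Var 1), L (Var 1) (Var 3)]
        \<leadsto> [L (Var 0) (Var 2), E (Var 2) (Con (letter_code a)) (Var 3)],
      [R (Var 0) (Var 2), E (Var 0) (Con (letter_code a)) (Var 1)]
        \<leadsto> [E (Var 2) (Con (letter_code a)) (Var 3), R (Var 1) (Var 3)]})"
proof -
  have letters: "UNIV = {Zero, One}"
    by (auto intro: letter.exhaust)
  have "range f = {f Zero, f One}" for f :: "letter \<Rightarrow> tgd set"
    unfolding letters by simp
  then show ?thesis
    unfolding context_tgds_def Let_def by (simp del: insert_iff add: insert_commute)
qed

lemma satisfies_left_context_tgd:
  "satisfies \<kappa> M ([E (Var 0) (Con c) (Var 1), L (Var 1) (Var 3)]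
     \<leadsto> [L (Var 0) (Var 2), E (Var 2) (Con c) (Var 3)]) \<longleftrightarrow>
   (\<forall>x0 x1 y1. E x0 (\<kappa> c) x1 \<in> M \<longrightarrow> L x1 y1 \<in> M \<longrightarrow> (\<exists>y0. L x0 y0 \<in> M \<and> E y0 (\<kappa> c) y1 \<in> M))"
  (is "satisfies _ _ ?\<xi> \<longleftrightarrow> ?r")
proof
  assume sat: "satisfies \<kappa> M ?\<xi>"
  show ?r
  proof (intro allI impI)
    fix x0 x1 y1 assume "E x0 (\<kappa> c) x1 \<in> M" "L x1 y1 \<in> M"
    then show "\<exists>y0. L x0 y0 \<in> M \<and> E y0 (\<kappa> c) y1 \<in> M"
      using sat[unfolded satisfies_def, rule_format, of "(\<lambda>_. x0)(1 := x1, 3 := y1)"]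
      by (auto simp: vars_def)
  qed
next
  assume r: ?r
  show "satisfies \<kappa> M ?\<xi>"
    unfolding satisfies_def
  proof (intro allI impI)
    fix h assume "map_atom (trm_eval \<kappa> h) ` set (body ?\<xi>) \<subseteq> M"
    then obtain y where "L (h 0) y \<in> M \<and> E y (\<kappa> c) (h 3) \<in> M"
      using r by fastforce
    then show "\<exists>h'. (\<forall>v\<in>vars (body ?\<xi>). h' v = h v) \<and> map_atom (trm_eval \<kappa> h') ` set (head ?\<xi>) \<subseteq> M"
      by (intro exI[of _ "h(2 := y)"]) (auto simp: vars_def)
  qed
qed

lemma satisfies_right_context_tgd:
  "satisfies \<kappa> M ([R (Var 0) (Var 2), E (Var 0) (Con c) (Var 1)]
     \<leadsto> [E (Var 2) (Con c) (Var 3), R (Var 1) (Var 3)]) \<longleftrightarrow>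
   (\<forall>x0 x1 y0. R x0 y0 \<in> M \<longrightarrow> E x0 (\<kappa> c) x1 \<in> M \<longrightarrow> (\<exists>y1. E y0 (\<kappa> c) y1 \<in> M \<and> R x1 y1 \<in> M))"
  (is "satisfies _ _ ?\<xi> \<longleftrightarrow> ?r")
proof
  assume sat: "satisfies \<kappa> M ?\<xi>"
  show ?r
  proof (intro allI impI)
    fix x0 x1 y0 assume "R x0 y0 \<in> M" "E x0 (\<kappa> c) x1 \<in> M"
    then show "\<exists>y1. E y0 (\<kappa> c) y1 \<in> M \<and> R x1 y1 \<in> M"
      using sat[unfolded satisfies_def, rule_format, of "(\<lambda>_. x0)(1 := x1, 2 := y0)"]
      by (auto simp: vars_def)
  qed
next
  assume r: ?r
  show "satisfies \<kappa> M ?\<xi>"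
    unfolding satisfies_def
  proof (intro allI impI)
    fix h assume "map_atom (trm_eval \<kappa> h) ` set (body ?\<xi>) \<subseteq> M"
    then obtain y where "E (h 2) (\<kappa> c) y \<in> M \<and> R (h 1) y \<in> M"
      using r by fastforce
    then show "\<exists>h'. (\<forall>v\<in>vars (body ?\<xi>). h' v = h v) \<and> map_atom (trm_eval \<kappa> h') ` set (head ?\<xi>) \<subseteq> M"
      by (intro exI[of _ "h(3 := y)"]) (auto simp: vars_def)
  qed
qed

lemma satisfies_context_tgds:
  "(\<forall>\<xi> \<in> context_tgds. satisfies \<kappa> M \<xi>) \<longleftrightarrow> context_closed \<kappa> M"
  unfolding context_tgds_alt context_closed_def
  by (simp only: ball_UN ball_simps satisfies_left_context_tgd satisfies_right_context_tgd)
    (simp add: all_conj_distrib)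

text \<open>Without existential variables the value of the head is determined by the body
  variables.\<close>

lemma satisfies_full:
  assumes "\<forall>v \<in> vars (head \<xi>). v \<in> vars (body \<xi>)"
  shows "satisfies \<kappa> M \<xi> \<longleftrightarrow> (\<forall>h. map_atom (trm_eval \<kappa> h) ` set (body \<xi>) \<subseteq> M \<longrightarrow>
    map_atom (trm_eval \<kappa> h) ` set (head \<xi>) \<subseteq> M)"
proof -
  have "map_atom (trm_eval \<kappa> h') ` set (head \<xi>) = map_atom (trm_eval \<kappa> h) ` set (head \<xi>)"
    if "\<forall>v \<in> vars (body \<xi>). h' v = h v" for h h'
  proof (intro image_cong refl atom.map_cong)
    fix A t assume "A \<in> set (head \<xi>)" "t \<in> set_atom A"
    then have "v \<in> vars (head \<xi>)" if "t = Var v" for v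
      using that by (auto simp: vars_def)
    then show "trm_eval \<kappa> h' t = trm_eval \<kappa> h t"
      using that assms by (cases t) auto
  qed
  then show ?thesis
    unfolding satisfies_def by metis
qed

text \<open>The domain and closure tgds use variables below 4 only, so quantifying over assignments
  amounts to quantifying over values.\<close>

lemma all_assignments:
  "(\<forall>h :: nat \<Rightarrow> 'a. P (h 0) (h 1) (h 2) (h 3)) \<longleftrightarrow> (\<forall>a b c d. P a b c d)"
proof safe
  fix a b c d assume "\<forall>h :: nat \<Rightarrow> 'a. P (h 0) (h 1) (h 2) (h 3)"
  from spec[OF this, of "(\<lambda>_. a)(1 := b, 2 := c, 3 := d)"] show "P a b c d"
    by simp
qed blast

lemma satisfies_domain_tgds:
  fixes M :: "'a atom set"
  shows "(\<forall>\<xi> \<in> domain_tgds. satisfies \<kappa> M \<xi>) \<longleftrightarrow> domain_closed \<kappa> M"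
proof -
  have "(\<forall>\<xi> \<in> domain_tgds. satisfies \<kappa> M \<xi>) \<longleftrightarrow>
    D (\<kappa> 0) \<in> M \<and> D (\<kappa> 1) \<in> M \<and>
    (\<forall>h :: nat \<Rightarrow> 'a. E (h 0) (h 2) (h 1) \<in> M \<longrightarrow> D (h 0) \<in> M \<and> D (h 2) \<in> M \<and> D (h 1) \<in> M) \<and>
    (\<forall>h :: nat \<Rightarrow> 'a. L (h 0) (h 1) \<in> M \<longrightarrow> D (h 0) \<in> M \<and> D (h 1) \<in> M) \<and>
    (\<forall>h :: nat \<Rightarrow> 'a. R (h 0) (h 1) \<in> M \<longrightarrow> D (h 0) \<in> M \<and> D (h 1) \<in> M) \<and>
    (\<forall>h :: nat \<Rightarrow> 'a. Estar (h 0) (h 1) \<in> M \<longrightarrow> D (h 0) \<in> M \<and> D (h 1) \<in> M)"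
    unfolding domain_tgds_def Let_def
    by (auto simp: satisfies_full vars_def)
  also have "\<dots> \<longleftrightarrow> domain_closed \<kappa> M"
    unfolding domain_closed_def
      all_assignments[where P = "\<lambda>a b c d. E a c b \<in> M \<longrightarrow> D a \<in> M \<and> D c \<in> M \<and> D b \<in> M"]
      all_assignments[where P = "\<lambda>a b c d. L a b \<in> M \<longrightarrow> D a \<in> M \<and> D b \<in> M"]
      all_assignments[where P = "\<lambda>a b c d. R a b \<in> M \<longrightarrow> D a \<in> M \<and> D b \<in> M"]
      all_assignments[where P = "\<lambda>a b c d. Estar a b \<in> M \<longrightarrow> D a \<in> M \<and> D b \<in> M"]
    by blast
  finally show ?thesis .
qed

lemma satisfies_closure_tgds:
  fixes M :: "'a atom set"
  shows "(\<forall>\<xi> \<in> closure_tgds. satisfies \<kappa> M \<xi>) \<longleftrightarrow> star_closed M"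
proof -
  have "(\<forall>\<xi> \<in> closure_tgds. satisfies \<kappa> M \<xi>) \<longleftrightarrow>
    (\<forall>h :: nat \<Rightarrow> 'a. E (h 0) (h 2) (h 1) \<in> M \<longrightarrow> Estar (h 0) (h 1) \<in> M) \<and>
    (\<forall>h :: nat \<Rightarrow> 'a. L (h 0) (h 1) \<in> M \<longrightarrow> Estar (h 0) (h 1) \<in> M) \<and>
    (\<forall>h :: nat \<Rightarrow> 'a. R (h 0) (h 1) \<in> M \<longrightarrow> Estar (h 0) (h 1) \<in> M) \<and>
    (\<forall>h :: nat \<Rightarrow> 'a. Estar (h 0) (h 1) \<in> M \<longrightarrow> Estar (h 1) (h 2) \<in> M \<longrightarrow> Estar (h 0) (h 2) \<in> M)"
    unfolding closure_tgds_def Let_def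
    by (auto simp: satisfies_full vars_def)
  also have "\<dots> \<longleftrightarrow> star_closed M"
    unfolding star_closed_def
      all_assignments[where P = "\<lambda>a b c d. E a c b \<in> M \<longrightarrow> Estar a b \<in> M"]
      all_assignments[where P = "\<lambda>a b c d. L a b \<in> M \<longrightarrow> Estar a b \<in> M"]
      all_assignments[where P = "\<lambda>a b c d. R a b \<in> M \<longrightarrow> Estar a b \<in> M"]
      all_assignments[where P = "\<lambda>a b c d. Estar a b \<in> M \<longrightarrow> Estar b c \<in> M \<longrightarrow> Estar a c \<in> M"]
    by blast
  finally show ?thesis .
qed

lemma satisfies_loop_tgds:
  assumes "\<And>v. Estar v v \<notin> M" "\<xi> \<in> loop_tgds"
  shows "satisfies \<kappa> M \<xi>"
  using assms unfolding loop_tgds_def Let_def satisfies_def by auto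

lemma satisfies_Sigma_of_closed:
  assumes "word_rewriting_system \<Theta>" "\<And>\<xi>. \<xi> \<in> \<Sigma>_of \<Theta> \<Longrightarrow> satisfies \<kappa> M \<xi>"
  shows "rule_closed \<kappa> \<Theta> M" "context_closed \<kappa> M" "domain_closed \<kappa> M" "star_closed M"
proof -
  show "context_closed \<kappa> M" "domain_closed \<kappa> M" "star_closed M"
    using assms(2) by (auto simp: \<Sigma>_of_def simp flip: satisfies_context_tgds satisfies_domain_tgds
      satisfies_closure_tgds[of \<kappa>])
  have "rule_closed \<kappa> {(l, r)} M" if "(l, r) \<in> \<Theta>" for l r
    using that assms by (subst satisfies_rule_tgd[symmetric])
      (auto simp: \<Sigma>_of_def word_rewriting_system_def)
  then show "rule_closed \<kappa> \<Theta> M"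
    by (fastforce simp: rule_closed_def)
qed

lemma closed_satisfies_Sigma_of:
  assumes "word_rewriting_system \<Theta>" "rule_closed \<kappa> \<Theta> M" "context_closed \<kappa> M" "domain_closed \<kappa> M"
    "star_closed M" "\<And>v. Estar v v \<notin> M" "\<xi> \<in> \<Sigma>_of \<Theta>"
  shows "satisfies \<kappa> M \<xi>"
proof -
  have "satisfies \<kappa> M (rule_tgd (l, r))" if "(l, r) \<in> \<Theta>" for l r
    using that assms(1,2) by (subst satisfies_rule_tgd)
      (auto simp: word_rewriting_system_def rule_closed_def)
  moreover have "\<forall>\<xi> \<in> context_tgds \<union> domain_tgds \<union> closure_tgds. satisfies \<kappa> M \<xi>"
    using assms satisfies_context_tgds satisfies_domain_tgds satisfies_closure_tgds by blast
  ultimately show ?thesis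
    using assms(7) satisfies_loop_tgds[OF assms(6)] by (auto simp: \<Sigma>_of_def)
qed

section \<open>The core chase and models\<close>

definition maps_into :: "('a \<Rightarrow> 'b) \<Rightarrow> (nat \<Rightarrow> 'a) \<Rightarrow> 'a atom set \<Rightarrow> (nat \<Rightarrow> 'b) \<Rightarrow> 'b atom set \<Rightarrow> bool" where
  "maps_into f \<kappa> I \<kappa>' M \<longleftrightarrow> (\<forall>c. f (\<kappa> c) = \<kappa>' c) \<and> map_atom f ` I \<subseteq> M"

lemma homomorphism_maps_into: "homomorphism I J f \<longleftrightarrow> maps_into f Const I Const J"
  by (simp add: homomorphism_def maps_into_def)

lemma maps_into_comp:
  assumes "maps_into f \<kappa> I \<kappa>' J" "maps_into g \<kappa>' J \<kappa>'' K"
  shows "maps_into (g \<circ> f) \<kappa> I \<kappa>'' K"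
  using assms by (force simp: maps_into_def atom.map_comp[symmetric])

lemma inst_trm_eval: "inst h As = map_atom (trm_eval Const (the \<circ> h)) ` set As"
proof -
  have "trm_val h = trm_eval Const (the \<circ> h)"
  proof
    fix t show "trm_val h t = trm_eval Const (the \<circ> h) t"
      by (cases t) auto
  qed
  then show ?thesis by (simp add: inst_def)
qed

lemma map_atom_trm_eval_cong:
  assumes "A \<in> set As" "\<And>v. v \<in> vars As \<Longrightarrow> h v = h' v"
  shows "map_atom (trm_eval \<kappa> h) A = map_atom (trm_eval \<kappa> h') A"
proof (rule atom.map_cong0)
  fix t assume "t \<in> set_atom A"
  then have "v \<in> vars As" if "t = Var v" for v
    using that assms(1) by (auto simp: vars_def)
  then show "trm_eval \<kappa> h t = trm_eval \<kappa> h' t"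
    using assms(2) by (cases t) auto
qed

lemma map_atom_trm_eval_comp:
  assumes "\<And>c. f (\<kappa> c) = \<kappa>' c"
  shows "map_atom f (map_atom (trm_eval \<kappa> h) A) = map_atom (trm_eval \<kappa>' (f \<circ> h)) A"
proof -
  have "f (trm_eval \<kappa> h t) = trm_eval \<kappa>' (f \<circ> h) t" for t
    using assms by (cases t) auto
  then show ?thesis
    by (auto simp: atom.map_comp intro: atom.map_cong0)
qed

lemma maps_into_trm_eval:
  assumes "maps_into f \<kappa> I \<kappa>' M" "map_atom (trm_eval \<kappa> h) ` set As \<subseteq> I"
  shows "map_atom (trm_eval \<kappa>' (f \<circ> h)) ` set As \<subseteq> M"
proof -
  have "map_atom (trm_eval \<kappa>' (f \<circ> h)) A \<in> M" if "A \<in> set As" for A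
  proof -
    have "map_atom f (map_atom (trm_eval \<kappa> h) A) \<in> M"
      using assms that unfolding maps_into_def by blast
    then show ?thesis
      using assms(1) map_atom_trm_eval_comp[of f \<kappa> \<kappa>'] by (simp add: maps_into_def)
  qed
  then show ?thesis by auto
qed

lemma occurs_in_eval:
  assumes "v \<in> vars As" "map_atom (trm_eval \<kappa> h) ` set As \<subseteq> I"
  shows "\<exists>A \<in> I. h v \<in> set_atom A"
proof -
  obtain A where A: "A \<in> set As" "Var v \<in> set_atom A"
    using assms(1) by (auto simp: vars_def)
  then have "trm_eval \<kappa> h (Var v) \<in> set_atom (map_atom (trm_eval \<kappa> h) A)"
    by (simp only: atom.set_map imageI)
  then show ?thesis
    using A assms(2) by auto
qed

text \<open>Each active trigger, viewed through \<open>g\<close>, has witnesses in \<open>M\<close>,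
  and its new nulls are sent there. Distinct nulls for distinct pairs make this a function;
  freshness leaves \<open>g\<close> unchanged on \<open>I\<close>.\<close>

lemma parallel_firing_maps_into:
  fixes M :: "'a atom set"
  assumes sat: "\<And>\<xi>. \<xi> \<in> \<Sigma> \<Longrightarrow> satisfies \<kappa> M \<xi>"
    and g: "maps_into g Const I \<kappa> M" and fir: "parallel_firing \<Sigma> I J"
  shows "\<exists>g'. maps_into g' Const J \<kappa> M"
proof -
  let ?T = "active_triggers \<Sigma> I"
  let ?S = "SIGMA t:?T. ex_vars (fst t)"
  obtain \<nu> where inj: "inj_on (\<lambda>(t, z). \<nu> t z) ?S"
    and fresh: "\<forall>t \<in> ?T. \<forall>z \<in> ex_vars (fst t). Null (\<nu> t z) \<notin> adom I"
    and J: "J = (\<Union>t \<in> ?T. fire I t (\<nu> t))"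
    using fir unfolding parallel_firing_def by blast
  have "\<exists>e. (\<forall>v \<in> vars (body (fst t)). e v = g (the (snd t v))) \<and>
      map_atom (trm_eval \<kappa> e) ` set (head (fst t)) \<subseteq> M" if "t \<in> ?T" for t
  proof -
    have "fst t \<in> \<Sigma>" "map_atom (trm_eval Const (the \<circ> snd t)) ` set (body (fst t)) \<subseteq> I"
      using that by (auto simp: active_triggers_def triggers_def inst_trm_eval)
    then show ?thesis
      using sat[unfolded satisfies_def, rule_format, OF _ maps_into_trm_eval[OF g],
        of "fst t" "the \<circ> snd t"] by simp
  qed
  then obtain e where e: "\<And>t v. t \<in> ?T \<Longrightarrow> v \<in> vars (body (fst t)) \<Longrightarrow> e t v = g (the (snd t v))"
    and head: "\<And>t. t \<in> ?T \<Longrightarrow> map_atom (trm_eval \<kappa> (e t)) ` set (head (fst t)) \<subseteq> M"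
    by metis
  define N where "N = (\<lambda>(t, z). Null (\<nu> t z))"
  \<comment> \<open>\<open>inv_into ?S N\<close> recovers the trigger and the variable for which a
    null was created.\<close>
  define g' where "g' v = (if v \<in> N ` ?S then case_prod e (inv_into ?S N v) else g v)" for v
  have injN: "inj_on N ?S"
    using inj by (auto simp: inj_on_def N_def)
  have new: "g' (Null (\<nu> t z)) = e t z" if "t \<in> ?T" "z \<in> ex_vars (fst t)" for t z
  proof -
    have S: "(t, z) \<in> ?S" and N: "Null (\<nu> t z) = N (t, z)"
      using that by (auto simp: N_def)
    show ?thesis
      unfolding N g'_def using S inv_into_f_f[OF injN S] by (simp del: mem_Sigma_iff)
  qed
  have old: "g' v = g v" if "v \<in> adom I" for v
    using that fresh by (fastforce simp: g'_def N_def)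
  have const: "g' (Const c) = \<kappa> c" for c
    using g by (auto simp: g'_def N_def maps_into_def)
  have "map_atom g' A \<in> M" if "A \<in> I" for A
  proof -
    have "map_atom g' A = map_atom g A"
      using that old by (intro atom.map_cong0) (auto simp: adom_def)
    then show ?thesis
      using that g by (auto simp: maps_into_def)
  qed
  moreover have "map_atom g' A \<in> M"
    if t: "t \<in> ?T"
      and A: "A \<in> inst (\<lambda>v. if v \<in> ex_vars (fst t) then Some (Null (\<nu> t v)) else snd t v) (head (fst t))"
    for t A
  proof -
    let ?k = "the \<circ> (\<lambda>v. if v \<in> ex_vars (fst t) then Some (Null (\<nu> t v)) else snd t v)"
    obtain B where B: "B \<in> set (head (fst t))" "A = map_atom (trm_eval Const ?k) B"
      using A unfolding inst_trm_eval by blast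
    have body: "map_atom (trm_eval Const (the \<circ> snd t)) ` set (body (fst t)) \<subseteq> I"
      using t by (auto simp: active_triggers_def triggers_def inst_trm_eval)
    have "(g' \<circ> ?k) v = e t v" if "v \<in> vars (head (fst t))" for v
    proof (cases "v \<in> ex_vars (fst t)")
      case True
      then show ?thesis using t new by simp
    next
      case False
      then have v: "v \<in> vars (body (fst t))"
        using that by (auto simp: ex_vars_def)
      then have "the (snd t v) \<in> adom I"
        using occurs_in_eval[OF _ body] by (auto simp: adom_def)
      then show ?thesis
        using False e[OF t v] old by simp
    qed
    then have "map_atom g' A = map_atom (trm_eval \<kappa> (e t)) B"
      unfolding B(2) map_atom_trm_eval_comp[of g' Const, OF const]
      by (rule map_atom_trm_eval_cong[OF B(1)])
    then show ?thesis
      using head[OF t] B(1) by auto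
  qed
  moreover have "fire I t (\<nu> t) =
      I \<union> inst (\<lambda>v. if v \<in> ex_vars (fst t) then Some (Null (\<nu> t v)) else snd t v) (head (fst t))" for t
    by (simp add: fire_def split_beta)
  ultimately have "map_atom g' ` J \<subseteq> M"
    unfolding J by blast
  then show ?thesis
    using const by (auto simp: maps_into_def)
qed

text \<open>Passing to a core only deletes atoms, so a map of the fired instance restricts to the
  next stage.\<close>

lemma core_chase_sequence_maps_into:
  assumes "\<And>\<xi>. \<xi> \<in> \<Sigma> \<Longrightarrow> satisfies \<kappa> M \<xi>" "core_chase_sequence \<Sigma> I Is" "maps_into g Const I \<kappa> M"
  shows "\<exists>g'. maps_into g' Const (Is n) \<kappa> M"
proof (induction n)
  case 0
  then show ?case
    using assms by (auto simp: core_chase_sequence_def)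
next
  case (Suc n)
  show ?case
  proof (cases "active_triggers \<Sigma> (Is n) = {}")
    case True
    then have "Is (Suc n) = Is n"
      using assms(2) by (auto simp: core_chase_sequence_def)
    then show ?thesis using Suc by simp
  next
    case False
    then have "core_chase_step \<Sigma> (Is n) (Is (Suc n))"
      using assms(2) by (auto simp: core_chase_sequence_def)
    then obtain J where J: "parallel_firing \<Sigma> (Is n) J" "Is (Suc n) \<subseteq> J"
      by (auto simp: core_chase_step_def is_core_def)
    obtain g' where "maps_into g' Const J \<kappa> M"
      using Suc parallel_firing_maps_into[OF assms(1) _ J(1)] by blast
    then have "maps_into g' Const (Is (Suc n)) \<kappa> M"
      using J(2) by (auto simp: maps_into_def)
    then show ?thesis
      by (intro exI[of _ g'])
  qed
qed

section \<open>Models as instances without active triggers\<close>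

definition restrict_vars :: "trm atom list \<Rightarrow> (nat \<Rightarrow> val) \<Rightarrow> nat \<rightharpoonup> val" where
  "restrict_vars As h v = (if v \<in> vars As then Some (h v) else None)"

lemma restrict_vars_trigger:
  assumes "\<xi> \<in> \<Sigma>" "map_atom (trm_eval Const h) ` set (body \<xi>) \<subseteq> I"
  shows "(\<xi>, restrict_vars (body \<xi>) h) \<in> triggers \<Sigma> I"
proof -
  have "inst (restrict_vars (body \<xi>) h) (body \<xi>) = map_atom (trm_eval Const h) ` set (body \<xi>)"
    unfolding inst_trm_eval
    by (intro image_cong refl map_atom_trm_eval_cong) (auto simp: restrict_vars_def)
  then show ?thesis
    using assms by (auto simp: triggers_def univ_vars_def dom_def restrict_vars_def)
qed

lemma restrict_vars_map_le:
  "restrict_vars As h \<subseteq>\<^sub>m k \<longleftrightarrow> (\<forall>v \<in> vars As. k v = Some (h v))"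
  by (auto simp: map_le_def restrict_vars_def dom_def)

text \<open>Triggers range over partial maps with prescribed domain, \<open>satisfies\<close> over
  total ones; restricting to the variables and applying \<open>the\<close> translate between the
  two.\<close>

lemma no_active_triggers_iff:
  "active_triggers \<Sigma> I = {} \<longleftrightarrow> (\<forall>\<xi> \<in> \<Sigma>. satisfies Const I \<xi>)"
proof
  assume none: "active_triggers \<Sigma> I = {}"
  show "\<forall>\<xi> \<in> \<Sigma>. satisfies Const I \<xi>"
    unfolding satisfies_def
  proof (intro ballI allI impI)
    fix \<xi> h assume \<xi>: "\<xi> \<in> \<Sigma>" and body: "map_atom (trm_eval Const h) ` set (body \<xi>) \<subseteq> I"
    obtain h' where "restrict_vars (body \<xi>) h \<subseteq>\<^sub>m h'" "inst h' (head \<xi>) \<subseteq> I"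
      using none restrict_vars_trigger[OF \<xi> body] unfolding active_triggers_def by blast
    moreover from this have "\<forall>v \<in> vars (body \<xi>). (the \<circ> h') v = h v"
      by (simp add: restrict_vars_map_le)
    ultimately show "\<exists>h'. (\<forall>v\<in>vars (body \<xi>). h' v = h v) \<and> map_atom (trm_eval Const h') ` set (head \<xi>) \<subseteq> I"
      unfolding inst_trm_eval by blast
  qed
next
  assume sat: "\<forall>\<xi> \<in> \<Sigma>. satisfies Const I \<xi>"
  have "(\<xi>, h) \<notin> active_triggers \<Sigma> I" for \<xi> h
  proof
    assume act: "(\<xi>, h) \<in> active_triggers \<Sigma> I"
    then have tr: "\<xi> \<in> \<Sigma>" "dom h = vars (body \<xi>)"
        "map_atom (trm_eval Const (the \<circ> h)) ` set (body \<xi>) \<subseteq> I"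
      by (auto simp: active_triggers_def triggers_def univ_vars_def inst_trm_eval)
    then obtain e where e: "\<forall>v \<in> vars (body \<xi>). e v = the (h v)"
        "map_atom (trm_eval Const e) ` set (head \<xi>) \<subseteq> I"
      using sat[unfolded satisfies_def, rule_format, of \<xi> "the \<circ> h"] by auto
    let ?h' = "\<lambda>v. if v \<in> univ_vars \<xi> \<union> ex_vars \<xi> then Some (e v) else None"
    have "inst ?h' (head \<xi>) = map_atom (trm_eval Const e) ` set (head \<xi>)"
      unfolding inst_trm_eval
      by (intro image_cong refl map_atom_trm_eval_cong) (auto simp: univ_vars_def ex_vars_def)
    moreover have "h \<subseteq>\<^sub>m ?h'"
      unfolding map_le_def
    proof
      fix v assume v: "v \<in> dom h"
      then have "e v = the (h v)" "v \<in> univ_vars \<xi>"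
        using e(1) tr(2) by (simp_all add: univ_vars_def)
      moreover obtain y where "h v = Some y"
        using v by blast
      ultimately show "h v = ?h' v"
        by simp
    qed
    moreover have "dom ?h' = univ_vars \<xi> \<union> ex_vars \<xi>"
      by (auto simp: dom_def)
    ultimately show False
      using act e(2) unfolding active_triggers_def by blast
  qed
  then show "active_triggers \<Sigma> I = {}"
    by auto
qed

text \<open>\<open>f\<close> is the folding of the fired instance into its core. An active trigger
  finds its head among the fired atoms, an inactive one already in \<open>I\<close>; folding carries
  both into \<open>I'\<close>. This is the form a limit needs: the body holds in one stage, the head
  in the next.\<close>

lemma core_chase_step_advances:
  assumes step: "core_chase_step \<Sigma> I I'" and nonempty: "active_triggers \<Sigma> I \<noteq> {}"
  shows "\<exists>f. homomorphism I I' f \<and>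
    (\<forall>\<xi> \<in> \<Sigma>. \<forall>h. map_atom (trm_eval Const h) ` set (body \<xi>) \<subseteq> I \<longrightarrow>
      (\<exists>h'. (\<forall>v \<in> vars (body \<xi>). h' v = f (h v)) \<and> map_atom (trm_eval Const h') ` set (head \<xi>) \<subseteq> I'))"
proof -
  obtain J where fir: "parallel_firing \<Sigma> I J" and core: "is_core J I'"
    using step by (auto simp: core_chase_step_def)
  obtain f where f: "maps_into f Const J Const I'"
    using core by (auto simp: is_core_def homomorphism_def maps_into_def)
  obtain \<nu> where J: "J = (\<Union>t \<in> active_triggers \<Sigma> I. fire I t (\<nu> t))"
    using fir by (auto simp: parallel_firing_def)
  \<comment> \<open>With no active trigger the union defining \<open>J\<close> would be empty and
    would lose \<open>I\<close>.\<close>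
  have I: "I \<subseteq> J"
    using nonempty by (fastforce simp: J fire_def split: prod.splits)
  have "\<exists>h'. (\<forall>v \<in> vars (body \<xi>). h' v = f (h v)) \<and> map_atom (trm_eval Const h') ` set (head \<xi>) \<subseteq> I'"
    if \<xi>: "\<xi> \<in> \<Sigma>" and body: "map_atom (trm_eval Const h) ` set (body \<xi>) \<subseteq> I" for \<xi> h
  proof -
    let ?h = "restrict_vars (body \<xi>) h"
    have "\<exists>k. ?h \<subseteq>\<^sub>m k \<and> inst k (head \<xi>) \<subseteq> J"
    proof (cases "(\<xi>, ?h) \<in> active_triggers \<Sigma> I")
      case True
      let ?k = "\<lambda>v. if v \<in> ex_vars \<xi> then Some (Null (\<nu> (\<xi>, ?h) v)) else ?h v"
      have "fire I (\<xi>, ?h) (\<nu> (\<xi>, ?h)) \<subseteq> J"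
        unfolding J using True by (rule UN_upper)
      then have "inst ?k (head \<xi>) \<subseteq> J"
        by (simp add: fire_def)
      moreover have "?h \<subseteq>\<^sub>m ?k"
        by (auto simp: restrict_vars_map_le restrict_vars_def ex_vars_def)
      ultimately show ?thesis by blast
    next
      case False
      then show ?thesis
        using restrict_vars_trigger[OF \<xi> body] I unfolding active_triggers_def by blast
    qed
    then obtain k where k: "?h \<subseteq>\<^sub>m k" "inst k (head \<xi>) \<subseteq> J"
      by blast
    have "\<forall>v \<in> vars (body \<xi>). (f \<circ> (the \<circ> k)) v = f (h v)"
      using k(1) by (simp add: restrict_vars_map_le)
    then show ?thesis
      using maps_into_trm_eval[OF f k(2)[unfolded inst_trm_eval]] by blast
  qed
  moreover have "homomorphism I I' f"
    using f I by (auto simp: homomorphism_maps_into maps_into_def)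
  ultimately show ?thesis by blast
qed

section \<open>Finiteness and rigidity of the stages\<close>

lemma core_chase_sequence_finite:
  assumes "finite \<Sigma>" "finite I" "core_chase_sequence \<Sigma> I Is"
  shows "finite (Is n)"
proof (induction n)
  case 0
  then show ?case using assms by (simp add: core_chase_sequence_def)
next
  case (Suc n)
  show ?case
  proof (cases "active_triggers \<Sigma> (Is n) = {}")
    case True
    then show ?thesis
      using Suc assms(3) by (auto simp: core_chase_sequence_def)
  next
    case False
    then have "core_chase_step \<Sigma> (Is n) (Is (Suc n))"
      using assms(3) by (auto simp: core_chase_sequence_def)
    then obtain J where "parallel_firing \<Sigma> (Is n) J" "Is (Suc n) \<subseteq> J"
      by (auto simp: core_chase_step_def is_core_def)
    moreover from this have "finite J"
      using Suc assms(1)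
      by (auto simp: parallel_firing_def fire_def inst_def finite_active_triggers split: prod.split)
    ultimately show ?thesis
      by (simp add: finite_subset)
  qed
qed

text \<open>\<open>is_core\<close> restricts only endomorphisms of the surrounding \<open>J\<close>.
  Preceded by the folding \<open>f\<close> of \<open>J\<close> into \<open>I\<close>, an
  endomorphism of \<open>I\<close> becomes one of \<open>J\<close>; as \<open>f\<close> maps the
  atoms of \<open>I\<close> onto \<open>I\<close>, the composite has the same image of
  \<open>I\<close> as \<open>g\<close>.\<close>

lemma core_endomorphism_surj:
  assumes "is_core J I" "endomorphism I g"
  shows "map_atom g ` I = I"
proof -
  obtain f where f: "homomorphism J I f" and I: "I \<subseteq> J"
    using assms(1) by (auto simp: is_core_def homomorphism_def)
  have no: "\<not> map_atom k ` I \<subset> I" if "homomorphism J I k" for k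
  proof
    assume "map_atom k ` I \<subset> I"
    moreover have "endomorphism J k"
      using that I by (auto simp: homomorphism_def)
    ultimately show False
      using assms(1) by (auto simp: is_core_def)
  qed
  have "map_atom k ` I = I" if k: "homomorphism J I k" for k
  proof -
    have "map_atom k ` I \<subseteq> I"
      using k I unfolding homomorphism_def by (meson image_mono order_trans)
    then show ?thesis
      using no[OF k] by (simp add: psubset_eq)
  qed
  note eq = this[OF f] this[OF homomorphism_comp[OF f assms(2)]]
  have "map_atom (g \<circ> f) ` I = map_atom g ` map_atom f ` I"
    by (simp add: image_image atom.map_comp)
  then show ?thesis
    unfolding eq by simp
qed

text \<open>The composite endomorphism is an automorphism of the finite core, and undoing it turns the
  extension found in the model into one of the original assignment.\<close>

lemma core_equivalent_model_satisfies:
  fixes M :: "'a atom set"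
  assumes "finite I" and surj: "\<And>g. endomorphism I g \<Longrightarrow> map_atom g ` I = I"
    and g: "maps_into g Const I \<kappa> M" and h: "maps_into h \<kappa> M Const I"
    and sat: "satisfies \<kappa> M \<xi>"
  shows "satisfies Const I \<xi>"
proof -
  define e where "e = h \<circ> g"
  have e: "endomorphism I e"
    unfolding e_def homomorphism_maps_into using maps_into_comp[OF g h] .
  have const: "e (Const c) = Const c" for c
    using e by (simp add: homomorphism_def)
  have "adom I = e ` adom I"
  proof -
    have "adom I = adom (map_atom e ` I)"
      using surj[OF e] by simp
    also have "\<dots> = e ` adom I"
      by (auto simp: adom_def atom.set_map)
    finally show ?thesis .
  qed
  then have inj: "inj_on e (adom I)"
    using finite_adom[OF assms(1)] by (intro eq_card_imp_inj_on) simp_all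
  \<comment> \<open>Values outside the active domain are kept, so that constants not occurring in
    \<open>I\<close> are fixed as well.\<close>
  define d where "d v = (if v \<in> adom I then inv_into (adom I) e v else v)" for v
  have d: "d (e v) = v" if "v \<in> adom I" for v
    using that inj \<open>adom I = e ` adom I\<close> by (metis d_def imageI inv_into_f_f)
  have "d (Const c) = Const c" for c
    using d[of "Const c"] const by (auto simp: d_def)
  \<comment> \<open>Injectivity on values alone would not make the inverse a homomorphism; that
    every atom of \<open>I\<close> is an image under \<open>e\<close> does.\<close>
  moreover have "map_atom d A \<in> I" if "A \<in> I" for A
  proof -
    have "A \<in> map_atom e ` I"
      using that surj[OF e] by simp
    then obtain B where B: "B \<in> I" "A = map_atom e B"
      by blast
    have "map_atom (d \<circ> e) B = map_atom id B"
      using B(1) d by (intro atom.map_cong0) (auto simp: adom_def)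
    then show ?thesis
      using B by (simp add: atom.map_comp atom.map_id)
  qed
  ultimately have "maps_into d Const I Const I"
    by (auto simp: maps_into_def)
  then have dh: "maps_into (d \<circ> h) \<kappa> M Const I"
    using h maps_into_comp by blast
  show ?thesis
    unfolding satisfies_def
  proof (intro allI impI)
    fix k assume body: "map_atom (trm_eval Const k) ` set (body \<xi>) \<subseteq> I"
    obtain k' where k': "\<forall>v \<in> vars (body \<xi>). k' v = (g \<circ> k) v"
        "map_atom (trm_eval \<kappa> k') ` set (head \<xi>) \<subseteq> M"
      using sat maps_into_trm_eval[OF g body] unfolding satisfies_def by blast
    have "((d \<circ> h) \<circ> k') v = k v" if "v \<in> vars (body \<xi>)" for v
      using k'(1) that occurs_in_eval[OF that body] d[of "k v"] by (auto simp: e_def adom_def)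
    then show "\<exists>h'. (\<forall>v\<in>vars (body \<xi>). h' v = k v) \<and> map_atom (trm_eval Const h') ` set (head \<xi>) \<subseteq> I"
      using maps_into_trm_eval[OF dh k'(2)] by blast
  qed
qed

section \<open>The limit of a chase sequence\<close>

text \<open>For a pair \<open>(n, v)\<close> and \<open>N\<close> above \<open>n\<close> this
  applies \<open>f n, ..., f (N - 1)\<close> to \<open>v\<close> in turn. For \<open>N\<close> up to
  \<open>n\<close> it returns \<open>v\<close>; below \<open>n\<close> this is a dummy value, which
  the bound on \<open>fst p\<close> in \<open>limit\<close> excludes.\<close>

primrec push :: "(nat \<Rightarrow> val \<Rightarrow> val) \<Rightarrow> nat \<Rightarrow> nat \<times> val \<Rightarrow> val" where
  "push f 0 p = snd p"
| "push f (Suc N) p = (if fst p \<le> N then f N (push f N p) else snd p)"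

text \<open>The pair \<open>(n, v)\<close> stands for the value \<open>v\<close> of stage \<open>n\<close> together with all its images in later
  stages. No quotient is needed, because tgds do not mention equality.\<close>

definition limit :: "(nat \<Rightarrow> val \<Rightarrow> val) \<Rightarrow> (nat \<Rightarrow> val atom set) \<Rightarrow> (nat \<times> val) atom set" where
  "limit f Is = {A. \<exists>N. (\<forall>p \<in> set_atom A. fst p \<le> N) \<and> map_atom (push f N) A \<in> Is N}"

abbreviation limit_const :: "nat \<Rightarrow> nat \<times> val" where
  "limit_const c \<equiv> (0, Const c)"

lemma push_const:
  assumes "\<And>n. homomorphism (Is n) (Is (Suc n)) (f n)"
  shows "push f N (limit_const c) = Const c"
  using assms by (induction N) (auto simp: homomorphism_def)

lemma push_persists:
  assumes hom: "\<And>n. homomorphism (Is n) (Is (Suc n)) (f n)"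
    and stage: "\<forall>p \<in> set_atom A. fst p \<le> N" and A: "map_atom (push f N) A \<in> Is N" and "N \<le> N'"
  shows "map_atom (push f N') A \<in> Is N'"
  using \<open>N \<le> N'\<close>
proof (induction N' rule: dec_induct)
  case base
  then show ?case using A .
next
  case (step n)
  have "map_atom (push f (Suc n)) A = map_atom (f n \<circ> push f n) A"
    using stage step.hyps(1) by (intro atom.map_cong0) auto
  also have "\<dots> = map_atom (f n) (map_atom (push f n) A)"
    by (simp add: atom.map_comp)
  also have "\<dots> \<in> Is (Suc n)"
    using hom[of n] step.IH by (auto simp: homomorphism_def)
  finally show ?case .
qed

text \<open>A compactness argument: atoms persist under \<open>push\<close>, so the latest of
  finitely many stages serves for all of them. The bound \<open>m\<close> lets a caller ask for a
  stage beyond the initial one.\<close>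

lemma finite_subset_limit_stage:
  assumes hom: "\<And>n. homomorphism (Is n) (Is (Suc n)) (f n)" and "finite X" "X \<subseteq> limit f Is"
  shows "\<exists>N \<ge> m. (\<forall>A \<in> X. \<forall>p \<in> set_atom A. fst p \<le> N) \<and> map_atom (push f N) ` X \<subseteq> Is N"
proof -
  have "\<forall>A \<in> X. \<exists>N. (\<forall>p \<in> set_atom A. fst p \<le> N) \<and> map_atom (push f N) A \<in> Is N"
    using assms(3) by (auto simp: limit_def)
  then obtain K where K: "\<And>A. A \<in> X \<Longrightarrow> (\<forall>p \<in> set_atom A. fst p \<le> K A)"
      "\<And>A. A \<in> X \<Longrightarrow> map_atom (push f (K A)) A \<in> Is (K A)"
    by metis
  let ?N = "Max (insert m (K ` X))"
  have le: "K A \<le> ?N" if "A \<in> X" for A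
    using that assms(2) by simp
  have "map_atom (push f ?N) A \<in> Is ?N" if "A \<in> X" for A
    using push_persists[of Is, OF hom K(1)[OF that] K(2)[OF that] le[OF that]] .
  moreover have "fst p \<le> ?N" if "A \<in> X" "p \<in> set_atom A" for A p
    using K(1) le that order_trans by blast
  moreover have "m \<le> ?N"
    using assms(2) by simp
  ultimately show ?thesis
    by blast
qed

text \<open>The body is finite, so it already holds in one stage, and the following stage supplies
  the head.\<close>

lemma limit_satisfies:
  assumes hom: "\<And>n. homomorphism (Is n) (Is (Suc n)) (f n)"
    and adv: "\<And>n h. map_atom (trm_eval Const h) ` set (body \<xi>) \<subseteq> Is n \<Longrightarrow>
      \<exists>h'. (\<forall>v \<in> vars (body \<xi>). h' v = f n (h v)) \<and>
        map_atom (trm_eval Const h') ` set (head \<xi>) \<subseteq> Is (Suc n)"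
  shows "satisfies limit_const (limit f Is) \<xi>"
  unfolding satisfies_def
proof (intro allI impI)
  fix h assume body: "map_atom (trm_eval limit_const h) ` set (body \<xi>) \<subseteq> limit f Is"
  note push_eval = map_atom_trm_eval_comp[of "push f N" limit_const Const for N, OF push_const[of Is, OF hom]]
  obtain N where N: "\<forall>A \<in> map_atom (trm_eval limit_const h) ` set (body \<xi>). \<forall>p \<in> set_atom A. fst p \<le> N"
      "map_atom (push f N) ` map_atom (trm_eval limit_const h) ` set (body \<xi>) \<subseteq> Is N"
    using finite_subset_limit_stage[of Is, OF hom _ body] by blast
  have "map_atom (trm_eval Const (push f N \<circ> h)) ` set (body \<xi>) \<subseteq> Is N"
    using N(2) by (simp add: image_image push_eval)
  from adv[OF this] obtain s where s: "\<forall>v \<in> vars (body \<xi>). s v = f N ((push f N \<circ> h) v)"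
      "map_atom (trm_eval Const s) ` set (head \<xi>) \<subseteq> Is (Suc N)"
    by blast
  \<comment> \<open>Body variables keep their pairs. The others enter at stage \<open>Suc N\<close>,
    where \<open>push\<close> leaves them unchanged, so that pushing \<open>h'\<close> to that stage
    gives \<open>s\<close>.\<close>
  define h' where "h' v = (if v \<in> vars (body \<xi>) then h v else (Suc N, s v))" for v
  have le: "fst (h v) \<le> N" if v: "v \<in> vars (body \<xi>)" for v
    using occurs_in_eval[OF v order_refl, of limit_const h] N(1) by blast
  have "fst (trm_eval limit_const h' t) \<le> Suc N" for t
    using le by (cases t) (auto simp: h'_def le_SucI)
  then have "\<forall>p \<in> set_atom (map_atom (trm_eval limit_const h') A). fst p \<le> Suc N" for A
    by (auto simp: atom.set_map)
  moreover have "push f (Suc N) \<circ> h' = s"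
    using le s(1) by (auto simp: h'_def fun_eq_iff)
  then have "map_atom (push f (Suc N)) (map_atom (trm_eval limit_const h') A) \<in> Is (Suc N)"
    if "A \<in> set (head \<xi>)" for A
    using that s(2) by (auto simp: push_eval simp del: push.simps)
  ultimately have "map_atom (trm_eval limit_const h') A \<in> limit f Is" if "A \<in> set (head \<xi>)" for A
    using that unfolding limit_def by blast
  then show "\<exists>h'. (\<forall>v\<in>vars (body \<xi>). h' v = h v) \<and>
      map_atom (trm_eval limit_const h') ` set (head \<xi>) \<subseteq> limit f Is"
    by (intro exI[of _ h']) (auto simp: h'_def)
qed

lemma limit_stage_0:
  assumes "\<And>n. homomorphism (Is n) (Is (Suc n)) (f n)"
  shows "maps_into (Pair 0) Const (Is 0) limit_const (limit f Is)"
proof -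
  have "map_atom (push f 0) (map_atom (Pair 0) A) = A" for A
    by (simp add: atom.map_comp o_def atom.map_ident)
  then have "map_atom (Pair 0) A \<in> limit f Is" if "A \<in> Is 0" for A
    using that by (auto simp: limit_def atom.set_map intro!: exI[of _ 0] simp del: push.simps)
  then show ?thesis
    by (auto simp: maps_into_def)
qed

lemma maps_into_limit_stage:
  assumes hom: "\<And>n. homomorphism (Is n) (Is (Suc n)) (f n)"
    and "finite U" and g: "maps_into g \<kappa> U limit_const (limit f Is)"
  shows "\<exists>N \<ge> m. \<exists>k. maps_into k \<kappa> U Const (Is N)"
proof -
  obtain N where N: "N \<ge> m" "map_atom (push f N) ` map_atom g ` U \<subseteq> Is N"
    using finite_subset_limit_stage[of Is f "map_atom g ` U" m, OF hom] assms(2) g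
    by (auto simp: maps_into_def)
  have "maps_into (push f N \<circ> g) \<kappa> U Const (Is N)"
    using N(2) g push_const[of Is, OF hom]
    by (auto simp: maps_into_def image_image atom.map_comp)
  then show ?thesis
    using N(1) by blast
qed

section \<open>Paths and rewriting steps in models\<close>

lemma is_path_append:
  "is_path \<kappa> M (u @ v) p \<longleftrightarrow> is_path \<kappa> M u p \<and> is_path \<kappa> M v (\<lambda>i. p (length u + i))"
proof -
  have "(\<forall>i < m + n. P i) \<longleftrightarrow> (\<forall>i < m. P i) \<and> (\<forall>i < n. P (m + i))" for P and m n :: nat
    by (metis add_less_cancel_left le_add_diff_inverse not_less trans_less_add1)
  then show ?thesis
    by (simp add: is_path_def nth_append)
qed

lemma is_path_cong:
  "(\<And>i. i \<le> length w \<Longrightarrow> p i = q i) \<Longrightarrow> is_path \<kappa> M w p \<longleftrightarrow> is_path \<kappa> M w q"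
  by (auto simp: is_path_def)

lemma is_path_Cons:
  "is_path \<kappa> M (a # w) p \<longleftrightarrow>
    E (p 0) (\<kappa> (letter_code a)) (p 1) \<in> M \<and> is_path \<kappa> M w (\<lambda>i. p (Suc i))"
  using is_path_append[of \<kappa> M "[a]" w p] by (simp add: is_path_def)

text \<open>The left context tgd carries an \<open>L\<close>-atom from the end of an edge to its
  start. Copying thus begins at the right end of \<open>x\<close>, and the induction treats the tail
  before the first letter.\<close>

lemma left_context:
  assumes "context_closed \<kappa> M" "is_path \<kappa> M x p" "L (p (length x)) z \<in> M"
  shows "\<exists>q. is_path \<kappa> M x q \<and> q (length x) = z \<and> (\<forall>i \<le> length x. L (p i) (q i) \<in> M)"
  using assms(2,3)
proof (induction x arbitrary: p)
  case Nil
  then show ?case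
    by (intro exI[of _ "\<lambda>_. z"]) (auto simp: is_path_def)
next
  case (Cons a x)
  obtain q where q: "is_path \<kappa> M x q" "q (length x) = z" "\<forall>i \<le> length x. L (p (Suc i)) (q i) \<in> M"
    using Cons.IH[of "\<lambda>i. p (Suc i)"] Cons.prems by (auto simp: is_path_Cons)
  have "E (p 0) (\<kappa> (letter_code a)) (p 1) \<in> M" "L (p 1) (q 0) \<in> M"
    using Cons.prems(1) q(3) by (auto simp: is_path_Cons)
  then obtain y where y: "L (p 0) y \<in> M" "E y (\<kappa> (letter_code a)) (q 0) \<in> M"
    using assms(1) unfolding context_closed_def by meson
  have "L (p i) (case_nat y q i) \<in> M" if "i \<le> length (a # x)" for i
    using that y(1) q(3) by (cases i) auto
  then show ?case
    using q y(2) by (intro exI[of _ "case_nat y q"]) (auto simp: is_path_Cons)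
qed

text \<open>Copying along \<open>R\<close> begins at the left end, so each letter moves the starting
  point \<open>z\<close> and the induction must generalize over it.\<close>

lemma right_context:
  assumes "context_closed \<kappa> M" "is_path \<kappa> M y p" "R (p 0) z \<in> M"
  shows "\<exists>q. is_path \<kappa> M y q \<and> q 0 = z \<and> (\<forall>i \<le> length y. R (p i) (q i) \<in> M)"
  using assms(2,3)
proof (induction y arbitrary: p z)
  case Nil
  then show ?case
    by (intro exI[of _ "\<lambda>_. z"]) (auto simp: is_path_def)
next
  case (Cons a y)
  have "E (p 0) (\<kappa> (letter_code a)) (p 1) \<in> M"
    using Cons.prems(1) by (simp add: is_path_Cons)
  then obtain z' where z': "E z (\<kappa> (letter_code a)) z' \<in> M" "R (p 1) z' \<in> M"
    using assms(1) Cons.prems(2) unfolding context_closed_def by meson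
  obtain q where q: "is_path \<kappa> M y q" "q 0 = z'" "\<forall>i \<le> length y. R (p (Suc i)) (q i) \<in> M"
    using Cons.IH[of "\<lambda>i. p (Suc i)" z'] Cons.prems z'(2) by (auto simp: is_path_Cons)
  have "R (p i) (case_nat z q i) \<in> M" if "i \<le> length (a # y)" for i
    using that Cons.prems(2) q(3) by (cases i) auto
  then show ?case
    using q z'(1) by (intro exI[of _ "case_nat z q"]) (auto simp: is_path_Cons)
qed

lemma is_path_glue:
  assumes "is_path \<kappa> M u p" "is_path \<kappa> M v q" "p (length u) = q 0"
  shows "\<exists>s. is_path \<kappa> M (u @ v) s \<and> (\<forall>i \<le> length u. s i = p i) \<and> (\<forall>i. s (length u + i) = q i)"
proof -
  let ?s = "\<lambda>i. if i \<le> length u then p i else q (i - length u)"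
  have s: "?s (length u + i) = q i" for i
    using assms(3) by (cases i) auto
  have "is_path \<kappa> M u ?s"
    using assms(1) is_path_cong[of u p ?s] by simp
  then have "is_path \<kappa> M (u @ v) ?s"
    unfolding is_path_append s using assms(2) by simp
  then show ?thesis
    using s by (intro exI[of _ ?s]) simp
qed

text \<open>A step records context and rule, not just the resulting word, so different steps between
  the same two words stay distinct.\<close>

type_synonym step = "word \<times> word \<times> word \<times> word"

definition redexes :: "(word \<times> word) set \<Rightarrow> word \<Rightarrow> step set" where
  "redexes \<Theta> u = {(x, l, r, y). (l, r) \<in> \<Theta> \<and> u = x @ l @ y}"

fun contract :: "step \<Rightarrow> word" where
  "contract (x, l, r, y) = x @ r @ y"

text \<open>\<open>L\<close> joins the positions of the left context up to the start of the redex,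
  \<open>R\<close> those of the right context from its end on. Positions strictly inside the redex
  have no links.\<close>

fun linked :: "'a atom set \<Rightarrow> (nat \<Rightarrow> 'a) \<Rightarrow> step \<Rightarrow> (nat \<Rightarrow> 'a) \<Rightarrow> bool" where
  "linked M p (x, l, r, y) q \<longleftrightarrow> (\<forall>i \<le> length x. L (p i) (q i) \<in> M) \<and>
     (\<forall>i \<le> length y. R (p (length x + length l + i)) (q (length x + length r + i)) \<in> M)"

lemma rewrite_step_redexes: "rewrite_step \<Theta> u v \<longleftrightarrow> (\<exists>s \<in> redexes \<Theta> u. v = contract s)"
  unfolding rewrite_step_def redexes_def Bex_def split_paired_Ex by simp blast

text \<open>Rule closure provides a path for \<open>r\<close> linked to both ends of the redex.
  These two links start the copying of \<open>x\<close> leftwards and of \<open>y\<close>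
  rightwards, and the three paths fit together.\<close>

lemma path_rewrite_step:
  assumes "rule_closed \<kappa> \<Theta> M" "context_closed \<kappa> M" "s \<in> redexes \<Theta> u" "is_path \<kappa> M u p"
  shows "\<exists>q. is_path \<kappa> M (contract s) q \<and> linked M p s q"
proof -
  obtain x l r y where s: "s = (x, l, r, y)" "(l, r) \<in> \<Theta>" "u = x @ l @ y"
    using assms(3) by (auto simp: redexes_def)
  let ?pl = "\<lambda>i. p (length x + i)"
  let ?py = "\<lambda>i. p (length x + length l + i)"
  have p: "is_path \<kappa> M x p" "is_path \<kappa> M l ?pl" "is_path \<kappa> M y ?py"
    using assms(4) by (simp_all add: s is_path_append add.assoc)
  obtain q where q: "is_path \<kappa> M r q" "L (?pl 0) (q 0) \<in> M" "R (?pl (length l)) (q (length r)) \<in> M"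
    using assms(1) s(2) p(2) unfolding rule_closed_def by blast
  obtain qx where qx: "is_path \<kappa> M x qx" "qx (length x) = q 0" "\<forall>i \<le> length x. L (p i) (qx i) \<in> M"
    using left_context[OF assms(2) p(1), of "q 0"] q(2) by auto
  obtain qy where qy: "is_path \<kappa> M y qy" "qy 0 = q (length r)" "\<forall>i \<le> length y. R (?py i) (qy i) \<in> M"
    using right_context[OF assms(2) p(3), of "q (length r)"] q(3) by auto
  obtain s1 where s1: "is_path \<kappa> M (r @ y) s1" "\<forall>i \<le> length r. s1 i = q i"
      "\<forall>i. s1 (length r + i) = qy i"
    using is_path_glue[OF q(1) qy(1)] qy(2) by auto
  obtain s2 where s2: "is_path \<kappa> M (x @ r @ y) s2" "\<forall>i \<le> length x. s2 i = qx i"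
      "\<forall>i. s2 (length x + i) = s1 i"
    using is_path_glue[OF qx(1) s1(1)] qx(2) s1(2) by auto
  have "s2 (length x + length r + i) = qy i" for i
    using s2(3) s1(3) by (simp add: add.assoc)
  then have "linked M p s s2"
    using s2(2) qx(3) qy(3) by (simp add: s)
  then show ?thesis
    using s2(1) s(1) by auto
qed

lemma word_instance_is_path:
  assumes "maps_into f Const (word_instance x w) \<kappa> M"
  shows "is_path \<kappa> M w (\<lambda>i. f (Null (x i)))"
proof -
  have "map_atom f (E (Null (x i)) (Const (letter_code (w ! i))) (Null (x (Suc i)))) \<in> M"
    if "i < length w" for i
    using assms that by (auto simp: maps_into_def word_instance_def path_def image_subset_iff)
  then show ?thesis
    using assms by (auto simp: is_path_def maps_into_def)
qed

lemma is_path_word_instance: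
  assumes "inj_on x {..length w}" "is_path \<kappa> M w p"
  shows "\<exists>f. maps_into f Const (word_instance x w) \<kappa> M"
proof -
  let ?f = "\<lambda>v. case v of Const c \<Rightarrow> \<kappa> c | Null n \<Rightarrow> p (inv_into {..length w} x n)"
  have "?f (Null (x i)) = p i" if "i \<le> length w" for i
    using that inv_into_f_f[OF assms(1)] by simp
  then have "maps_into ?f Const (word_instance x w) \<kappa> M"
    using assms(2) by (auto simp: maps_into_def word_instance_def path_def is_path_def)
  then show ?thesis by (intro exI[of _ ?f])
qed

section \<open>An acyclic model\<close>

text \<open>The first coordinate of an element is the number of the word in a derivation, the second one
  the position in that word: \<open>L\<close> and \<open>R\<close> lead to the next word, \<open>E\<close> to the next position.\<close>

definition grid_less :: "int \<times> int \<Rightarrow> int \<times> int \<Rightarrow> bool" where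
  "grid_less p q \<longleftrightarrow> fst p < fst q \<or> fst p = fst q \<and> snd p < snd q"

definition grid :: "(int \<times> int) atom set" where
  "grid = {E p z q | p z q. fst q = fst p \<and> snd q = snd p + 1} \<union> {Estar p q | p q. grid_less p q}
     \<union> {L p q | p q. fst q = fst p + 1} \<union> {R p q | p q. fst q = fst p + 1} \<union> range D"

lemma grid_atoms [simp]:
  "E p z q \<in> grid \<longleftrightarrow> fst q = fst p \<and> snd q = snd p + 1"
  "Estar p q \<in> grid \<longleftrightarrow> grid_less p q"
  "L p q \<in> grid \<longleftrightarrow> fst q = fst p + 1"
  "R p q \<in> grid \<longleftrightarrow> fst q = fst p + 1"
  "D p \<in> grid"
  by (cases p; cases q; auto simp: grid_def)+

text \<open>An \<open>E\<close>-atom of the grid puts no condition on its label, so all constants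
  may share one element.\<close>

lemma grid_satisfies:
  assumes "word_rewriting_system \<Theta>" "\<xi> \<in> \<Sigma>_of \<Theta>"
  shows "satisfies (\<lambda>_. (0, 0)) grid \<xi>"
proof (rule closed_satisfies_Sigma_of[OF assms(1) _ _ _ _ _ assms(2)])
  show "rule_closed (\<lambda>_. (0, 0)) \<Theta> grid"
    unfolding rule_closed_def
  proof safe
    fix l r and p :: "nat \<Rightarrow> int \<times> int"
    assume lr: "(l, r) \<in> \<Theta>" and p: "is_path (\<lambda>_. (0, 0)) grid l p"
    \<comment> \<open>An \<open>E\<close>-path stays in one row. Hence \<open>L\<close> from its
      start and \<open>R\<close> from its end lead to the same next row, where any column is
      allowed.\<close>
    have "fst (p i) = fst (p 0)" if "i \<le> length l" for i
      using that p by (induction i) (auto simp: is_path_def)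
    from this[of "length l"] show "\<exists>q. is_path (\<lambda>_. (0, 0)) grid r q \<and> L (p 0) (q 0) \<in> grid \<and>
        R (p (length l)) (q (length r)) \<in> grid"
      by (intro exI[of _ "\<lambda>j. (fst (p 0) + 1, int j)"]) (auto simp: is_path_def)
  qed
  show "context_closed (\<lambda>_. (0, 0)) grid"
    unfolding context_closed_def
  proof (intro conjI allI impI)
    fix x0 x1 y1 :: "int \<times> int"
    assume "E x0 (0, 0) x1 \<in> grid" "L x1 y1 \<in> grid"
    \<comment> \<open>Columns are integers so that this predecessor always exists.\<close>
    then show "\<exists>y0. L x0 y0 \<in> grid \<and> E y0 (0, 0) y1 \<in> grid"
      by (intro exI[of _ "(fst y1, snd y1 - 1)"]) simp
  next
    fix x0 x1 y0 :: "int \<times> int"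
    assume "R x0 y0 \<in> grid" "E x0 (0, 0) x1 \<in> grid"
    then show "\<exists>y1. E y0 (0, 0) y1 \<in> grid \<and> R x1 y1 \<in> grid"
      by (intro exI[of _ "(fst y0, snd y0 + 1)"]) simp
  qed
qed (auto simp: grid_less_def domain_closed_def star_closed_def)

section \<open>Acyclic stages, and cycles forced by infinite derivations\<close>

lemma core_chase_sequence_acyclic:
  assumes "word_rewriting_system \<Theta>" "inj_on x {..length w}"
    "core_chase_sequence (\<Sigma>_of \<Theta>) (word_instance x w) Is"
  shows "Estar v v \<notin> Is n"
proof
  have "is_path (\<lambda>_. (0, 0)) grid w (\<lambda>i. (0, int i))"
    by (simp add: is_path_def)
  then obtain g where g: "maps_into g Const (Is n) (\<lambda>_. (0, 0)) grid"
    using is_path_word_instance[OF assms(2)]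
      core_chase_sequence_maps_into[OF grid_satisfies[OF assms(1)] assms(3)] by blast
  assume "Estar v v \<in> Is n"
  then have "map_atom g (Estar v v) \<in> grid"
    using g unfolding maps_into_def by blast
  then show False
    by (simp add: grid_less_def)
qed

lemma core_chase_sequence_homomorphism:
  assumes "core_chase_sequence \<Sigma> I Is"
  shows "\<exists>f. homomorphism I (Is n) f"
proof (induction n)
  case 0
  have "homomorphism I I id"
    by (simp add: homomorphism_def atom.map_id0)
  moreover have "Is 0 = I"
    using assms by (simp add: core_chase_sequence_def)
  ultimately show ?case
    by blast
next
  case (Suc n)
  show ?case
  proof (cases "active_triggers \<Sigma> (Is n) = {}")
    case True
    then have "Is (Suc n) = Is n"
      using assms by (auto simp: core_chase_sequence_def)
    then show ?thesis
      using Suc by simp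
  next
    case False
    then have "core_chase_step \<Sigma> (Is n) (Is (Suc n))"
      using assms by (auto simp: core_chase_sequence_def)
    then obtain f where "homomorphism (Is n) (Is (Suc n)) f"
      using core_chase_step_advances[OF _ False] by blast
    moreover obtain g where "homomorphism I (Is n) g"
      using Suc by blast
    ultimately have "homomorphism I (Is (Suc n)) (f \<circ> g)"
      by (intro homomorphism_comp)
    then show ?thesis
      by (intro exI[of _ "f \<circ> g"])
  qed
qed

text \<open>Position 0 lies in the left context or starts the redex, whatever the step, so the
  starts of successive paths are joined by \<open>L\<close>. In a finite structure two of these
  starts coincide, and transitivity of \<open>Estar\<close> closes the cycle.\<close>

lemma infinite_derivation_cycle:
  fixes M :: "'a atom set"
  assumes "finite M" "rule_closed \<kappa> \<Theta> M" "context_closed \<kappa> M" "star_closed M"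
    "is_path \<kappa> M (ws 0) p" "infinite_derivation \<Theta> ws"
  shows "\<exists>v. Estar v v \<in> M"
proof -
  have "\<exists>q. \<forall>n. is_path \<kappa> M (ws n) (q n) \<and> L (q n 0) (q (Suc n) 0) \<in> M"
  proof (rule dependent_nat_choice)
    show "\<exists>p. is_path \<kappa> M (ws 0) p"
      using assms(5) by blast
  next
    fix p n assume p: "is_path \<kappa> M (ws n) p"
    obtain s where s: "s \<in> redexes \<Theta> (ws n)" "ws (Suc n) = contract s"
      using assms(6) unfolding infinite_derivation_def rewrite_step_redexes by blast
    obtain q where "is_path \<kappa> M (ws (Suc n)) q" "linked M p s q"
      using path_rewrite_step[OF assms(2,3) s(1) p] s(2) by auto
    then show "\<exists>q. is_path \<kappa> M (ws (Suc n)) q \<and> L (p 0) (q 0) \<in> M"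
      by (cases s) auto
  qed
  then obtain q :: "nat \<Rightarrow> nat \<Rightarrow> 'a" where q: "\<And>n. L (q n 0) (q (Suc n) 0) \<in> M"
    by blast
  have star: "Estar (q n 0) (q (n + Suc k) 0) \<in> M" for n k
  proof (induction k)
    case 0
    then show ?case
      using q[of n] assms(4) by (auto simp: star_closed_def)
  next
    case (Suc k)
    then show ?case
      using q[of "n + Suc k"] assms(4) unfolding star_closed_def by (metis add_Suc_right)
  qed
  have "finite (set_atom A)" for A :: "'a atom"
    by (cases A) auto
  then have "finite (\<Union>A \<in> M. set_atom A)"
    using assms(1) by blast
  moreover have "range (\<lambda>n. q n 0) \<subseteq> (\<Union>A \<in> M. set_atom A)"
    using q by fastforce
  ultimately have "finite (range (\<lambda>n. q n 0))"
    by (rule finite_subset[rotated])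
  then have "\<not> inj (\<lambda>n. q n 0)"
    using finite_imageD infinite_UNIV_nat by blast
  then obtain m n where "m < n" "q m 0 = q n 0"
    by (metis (mono_tags, lifting) injI nat_neq_iff)
  then show ?thesis
    using star[of m "n - Suc m"] by auto
qed

section \<open>The derivation tree as a model\<close>

fun valid :: "(word \<times> word) set \<Rightarrow> word \<Rightarrow> step list \<Rightarrow> bool" where
  "valid \<Theta> u [] \<longleftrightarrow> True"
| "valid \<Theta> u (s # ds) \<longleftrightarrow> s \<in> redexes \<Theta> u \<and> valid \<Theta> (contract s) ds"

text \<open>A step carries its whole context, so the fold discards the word obtained so far and only
  the last step counts.\<close>

definition result :: "word \<Rightarrow> step list \<Rightarrow> word" where
  "result u ds = foldl (\<lambda>_. contract) u ds"

lemma result_simps [simp]: "result u [] = u" "result u (ds @ [s]) = contract s"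
  by (simp_all add: result_def)

lemma valid_snoc: "valid \<Theta> u (ds @ [s]) \<longleftrightarrow> valid \<Theta> u ds \<and> s \<in> redexes \<Theta> (result u ds)"
  by (induction ds arbitrary: u) (auto simp: result_def)

lemma finite_redexes:
  assumes "finite \<Theta>"
  shows "finite (redexes \<Theta> u)"
proof -
  let ?f = "\<lambda>(i, l, r). (take i u, l, r, drop (i + length l) u)"
  have "redexes \<Theta> u \<subseteq> ?f ` ({..length u} \<times> \<Theta>)"
  proof
    fix s assume "s \<in> redexes \<Theta> u"
    then obtain x l r y where s: "s = (x, l, r, y)" "(l, r) \<in> \<Theta>" "u = x @ l @ y"
      by (auto simp: redexes_def)
    then show "s \<in> ?f ` ({..length u} \<times> \<Theta>)"
      by (intro image_eqI[of _ _ "(length x, l, r)"]) auto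
  qed
  then show ?thesis
    by (rule finite_subset) (use assms in simp)
qed

text \<open>Koenig's lemma as well-founded induction: without infinite derivations \<open>w\<close>
  is accessible for the converse of rewriting, and finite branching passes finiteness from the
  children of a node to the node.\<close>

lemma finite_valid:
  assumes "finite \<Theta>" and none: "\<nexists>ws. ws 0 = w \<and> infinite_derivation \<Theta> ws"
  shows "finite {ds. valid \<Theta> w ds}"
proof -
  let ?R = "\<lambda>v u. rewrite_step \<Theta> u v"
  have "Wellfounded.accp ?R w"
  proof (rule ccontr)
    assume "\<not> Wellfounded.accp ?R w"
    \<comment> \<open>A word that is not accessible has a successor that is not accessible;
      dependent choice strings these into an infinite derivation.\<close>
    then have "\<exists>ws. \<forall>n. (\<not> Wellfounded.accp ?R (ws n) \<and> (n = 0 \<longrightarrow> ws n = w)) \<and> ?R (ws (Suc n)) (ws n)"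
      by (intro dependent_nat_choice) (auto dest: not_accp_down)
    then show False
      using none by (auto simp: infinite_derivation_def)
  qed
  then show ?thesis
  proof (induction w rule: accp.induct)
    case (accI u)
    have "{ds. valid \<Theta> u ds} \<subseteq> {[]} \<union> (\<Union>s \<in> redexes \<Theta> u. (#) s ` {ds. valid \<Theta> (contract s) ds})"
    proof
      fix ds assume "ds \<in> {ds. valid \<Theta> u ds}"
      then show "ds \<in> {[]} \<union> (\<Union>s \<in> redexes \<Theta> u. (#) s ` {ds. valid \<Theta> (contract s) ds})"
        by (cases ds) auto
    qed
    moreover have "finite {ds. valid \<Theta> (contract s) ds}" if "s \<in> redexes \<Theta> u" for s
      using accI that rewrite_step_redexes by blast
    then have "finite ({[]} \<union> (\<Union>s \<in> redexes \<Theta> u. (#) s ` {ds. valid \<Theta> (contract s) ds}))"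
      using finite_redexes[OF assms(1), of u] by (intro finite_UnI finite_UN_I finite_imageI) simp_all
    ultimately show ?case
      by (rule finite_subset)
  qed
qed

text \<open>\<open>Vertex ds i\<close> is position \<open>i\<close> in the word reached by the
  derivation \<open>ds\<close>. Keeping the whole history makes this a tree; \<open>Label\<close>
  interprets the constants.\<close>

datatype node = Label nat | Vertex "step list" nat

inductive_set tree_base :: "(word \<times> word) set \<Rightarrow> word \<Rightarrow> node atom set" for \<Theta> w where
  edge: "valid \<Theta> w ds \<Longrightarrow> i < length (result w ds) \<Longrightarrow>
    E (Vertex ds i) (Label (letter_code (result w ds ! i))) (Vertex ds (Suc i)) \<in> tree_base \<Theta> w"
| left: "valid \<Theta> w (ds @ [(x, l, r, y)]) \<Longrightarrow> i \<le> length x \<Longrightarrow>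
    L (Vertex ds i) (Vertex (ds @ [(x, l, r, y)]) i) \<in> tree_base \<Theta> w"
| right: "valid \<Theta> w (ds @ [(x, l, r, y)]) \<Longrightarrow> i \<le> length y \<Longrightarrow>
    R (Vertex ds (length x + length l + i)) (Vertex (ds @ [(x, l, r, y)]) (length x + length r + i))
      \<in> tree_base \<Theta> w"

lemma finite_tree_base:
  assumes "finite {ds. valid \<Theta> w ds}"
  shows "finite (tree_base \<Theta> w)"
proof -
  define es where "es ds =
    (\<lambda>i. E (Vertex ds i) (Label (letter_code (result w ds ! i))) (Vertex ds (Suc i)))
      ` {..<length (result w ds)}" for ds
  \<comment> \<open>For empty \<open>ds\<close> the value of \<open>last\<close> is unspecified;
    this is harmless, as only a finite superset is wanted.\<close>
  define lrs where "lrs ds = (case last ds of (x, l, r, y) \<Rightarrow>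
    (\<lambda>i. L (Vertex (butlast ds) i) (Vertex ds i)) ` {..length x} \<union>
    (\<lambda>i. R (Vertex (butlast ds) (length x + length l + i)) (Vertex ds (length x + length r + i)))
      ` {..length y})" for ds
  have "A \<in> (\<Union>ds \<in> {ds. valid \<Theta> w ds}. es ds \<union> lrs ds)" if "A \<in> tree_base \<Theta> w" for A
    using that
  proof cases
    case (edge ds i)
    then have "A \<in> es ds"
      by (simp add: es_def)
    then show ?thesis
      using edge(2) by blast
  next
    case (left ds x l r y i)
    then have "A \<in> lrs (ds @ [(x, l, r, y)])"
      by (simp add: lrs_def)
    then show ?thesis
      using left(2) by blast
  next
    case (right ds x l r y i)
    then have "A \<in> lrs (ds @ [(x, l, r, y)])"
      by (simp add: lrs_def)
    then show ?thesis
      using right(2) by blast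
  qed
  then have "tree_base \<Theta> w \<subseteq> (\<Union>ds \<in> {ds. valid \<Theta> w ds}. es ds \<union> lrs ds)"
    by blast
  moreover have "finite (es ds)" "finite (lrs ds)" for ds
    by (simp_all add: es_def lrs_def split: prod.split)
  then have "finite (\<Union>ds \<in> {ds. valid \<Theta> w ds}. es ds \<union> lrs ds)"
    using assms by blast
  ultimately show ?thesis
    by (rule finite_subset)
qed

section \<open>Closure under the tgds for \<open>Estar\<close> and \<open>D\<close>\<close>

definition edge_rel :: "'a atom set \<Rightarrow> ('a \<times> 'a) set" where
  "edge_rel B = {(p, q). (\<exists>z. E p z q \<in> B) \<or> L p q \<in> B \<or> R p q \<in> B}"

text \<open>For a set of \<open>E\<close>-, \<open>L\<close>- and \<open>R\<close>-atoms this is the closure under the tgds for \<open>E\<^sup>*\<close> and \<open>D\<close>.\<close>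

definition saturate :: "(nat \<Rightarrow> 'a) \<Rightarrow> 'a atom set \<Rightarrow> 'a atom set" where
  "saturate \<kappa> B = B \<union> (\<lambda>(p, q). Estar p q) ` (edge_rel B)\<^sup>+ \<union>
     D ` ({\<kappa> 0, \<kappa> 1} \<union> (\<Union>A \<in> B. set_atom A))"

lemma finite_saturate:
  assumes "finite B"
  shows "finite (saturate \<kappa> B)"
proof -
  have fin: "finite (\<Union>A \<in> B. set_atom A)"
  proof -
    have "finite (set_atom A)" for A :: "'a atom"
      by (cases A) auto
    then show ?thesis
      using assms by blast
  qed
  have "edge_rel B \<subseteq> (\<Union>A \<in> B. set_atom A) \<times> (\<Union>A \<in> B. set_atom A)"
    by (force simp: edge_rel_def)
  then have "finite (edge_rel B)"
    using fin finite_subset by blast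
  then show ?thesis
    using fin assms by (simp add: saturate_def)
qed

text \<open>Each atom added by saturation is forced in \<open>M\<close> by the same tgds, so
  \<open>f\<close> needs no change.\<close>

lemma saturate_maps_into:
  assumes f: "maps_into f \<kappa> B \<kappa>' M" and M: "star_closed M" "domain_closed \<kappa>' M"
  shows "maps_into f \<kappa> (saturate \<kappa> B) \<kappa>' M"
proof -
  have B: "map_atom f A \<in> M" if "A \<in> B" for A
    using f that by (auto simp: maps_into_def)
  have edge: "Estar (f p) (f q) \<in> M" if "(p, q) \<in> edge_rel B" for p q
    using that M(1) B unfolding edge_rel_def star_closed_def by fastforce
  have "Estar (f p) (f q) \<in> M" if "(p, q) \<in> (edge_rel B)\<^sup>+" for p q
    using that
  proof induction
    case (base q)
    then show ?case by (rule edge)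
  next
    case (step q q')
    then show ?case
      using edge M(1) unfolding star_closed_def by blast
  qed
  moreover have "D q \<in> M" if "A \<in> M" "q \<in> set_atom A" for q A
    using that M(2) by (cases A) (auto simp: domain_closed_def)
  then have "D (f p) \<in> M" if "A \<in> B" "p \<in> set_atom A" for p A
    using that B[OF that(1)] by (fastforce simp: atom.set_map)
  moreover have "D (f (\<kappa> 0)) \<in> M" "D (f (\<kappa> 1)) \<in> M"
    using f M(2) by (auto simp: maps_into_def domain_closed_def)
  ultimately have "map_atom f A \<in> M" if "A \<in> saturate \<kappa> B" for A
    using that B by (auto simp: saturate_def)
  then show ?thesis
    using f by (auto simp: maps_into_def)
qed

section \<open>The tree is an acyclic model and maps into every model\<close>

definition tree_model :: "(word \<times> word) set \<Rightarrow> word \<Rightarrow> node atom set" where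
  "tree_model \<Theta> w = saturate Label (tree_base \<Theta> w)"

lemma tree_base_atoms:
  "Estar p q \<notin> tree_base \<Theta> w" "D p \<notin> tree_base \<Theta> w"
  by (auto elim: tree_base.cases)

lemma tree_model_atoms:
  "E p z q \<in> tree_model \<Theta> w \<longleftrightarrow> E p z q \<in> tree_base \<Theta> w"
  "L p q \<in> tree_model \<Theta> w \<longleftrightarrow> L p q \<in> tree_base \<Theta> w"
  "R p q \<in> tree_model \<Theta> w \<longleftrightarrow> R p q \<in> tree_base \<Theta> w"
  "Estar p q \<in> tree_model \<Theta> w \<longleftrightarrow> (p, q) \<in> (edge_rel (tree_base \<Theta> w))\<^sup>+"
  "D p \<in> tree_model \<Theta> w \<longleftrightarrow> p \<in> {Label 0, Label 1} \<union> (\<Union>A \<in> tree_base \<Theta> w. set_atom A)"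
  by (auto simp: tree_model_def saturate_def tree_base_atoms)

text \<open>An \<open>E\<close>-atom keeps the derivation and raises the position by one, so a path
  spells out a factor of a single word. The first edge is what shows that \<open>p 0\<close> is a
  vertex, hence the nonempty \<open>l\<close>.\<close>

lemma tree_path:
  assumes "is_path Label (tree_model \<Theta> w) l p" "l \<noteq> []"
  shows "\<exists>ds x y. valid \<Theta> w ds \<and> result w ds = x @ l @ y \<and>
    (\<forall>j \<le> length l. p j = Vertex ds (length x + j))"
proof -
  have E: "E (p j) (Label (letter_code (l ! j))) (p (Suc j)) \<in> tree_base \<Theta> w" if "j < length l" for j
    using assms(1) that by (simp add: is_path_def tree_model_atoms)
  obtain ds i where p0: "p 0 = Vertex ds i" and ds: "valid \<Theta> w ds"
    using E[of 0] assms(2) by (auto elim: tree_base.cases)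
  have inj: "a = b" if "letter_code a = letter_code b" for a b
    using that by (cases a; cases b) auto
  have step: "i + j < length (result w ds) \<and> result w ds ! (i + j) = l ! j \<and> p (Suc j) = Vertex ds (i + Suc j)"
    if "j < length l" "p j = Vertex ds (i + j)" for j
    using E[OF that(1)] unfolding that(2) by (cases rule: tree_base.cases) (auto dest: inj)
  have p: "p j = Vertex ds (i + j)" if "j \<le> length l" for j
    using that
  proof (induction j)
    case (Suc j)
    then show ?case using step[of j] by simp
  qed (simp add: p0)
  have len: "i + length l \<le> length (result w ds)"
    using step[of "length l - 1"] p[of "length l - 1"] assms(2) by (cases l) auto
  have l: "take (length l) (drop i (result w ds)) = l"
    using step p len by (intro nth_equalityI) auto
  have "result w ds = take i (result w ds) @ l @ drop (length l) (drop i (result w ds))"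
    by (metis append_take_drop_id l)
  moreover have "length (take i (result w ds)) = i"
    using len by simp
  ultimately show ?thesis
    using ds p by metis
qed

text \<open>A path labelled by a left-hand side is a redex of some node, and the child for that
  redex carries the required path.\<close>

lemma tree_rule_closed:
  assumes "word_rewriting_system \<Theta>"
  shows "rule_closed Label \<Theta> (tree_model \<Theta> w)"
  unfolding rule_closed_def
proof safe
  fix l r p assume lr: "(l, r) \<in> \<Theta>" and p: "is_path Label (tree_model \<Theta> w) l p"
  then have "l \<noteq> []"
    using assms by (auto simp: word_rewriting_system_def)
  then obtain ds x y where ds: "valid \<Theta> w ds" "result w ds = x @ l @ y"
      and p: "\<And>j. j \<le> length l \<Longrightarrow> p j = Vertex ds (length x + j)"
    using tree_path[OF p] by blast
  let ?ds = "ds @ [(x, l, r, y)]"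
  have valid: "valid \<Theta> w ?ds"
    using ds lr by (simp add: valid_snoc redexes_def)
  have "is_path Label (tree_model \<Theta> w) r (\<lambda>j. Vertex ?ds (length x + j))"
    unfolding is_path_def
  proof (intro allI impI)
    fix j assume "j < length r"
    then show "E (Vertex ?ds (length x + j)) (Label (letter_code (r ! j)))
        (Vertex ?ds (length x + Suc j)) \<in> tree_model \<Theta> w"
      using tree_base.edge[OF valid, of "length x + j"] by (simp add: tree_model_atoms nth_append)
  qed
  moreover have "L (p 0) (Vertex ?ds (length x + 0)) \<in> tree_model \<Theta> w"
    using tree_base.left[OF valid, of "length x"] by (simp add: tree_model_atoms p)
  moreover have "R (p (length l)) (Vertex ?ds (length x + length r)) \<in> tree_model \<Theta> w"
    using tree_base.right[OF valid, of 0] by (simp add: tree_model_atoms p)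
  ultimately show "\<exists>q. is_path Label (tree_model \<Theta> w) r q \<and> L (p 0) (q 0) \<in> tree_model \<Theta> w \<and>
      R (p (length l)) (q (length r)) \<in> tree_model \<Theta> w"
    by (intro exI[of _ "\<lambda>j. Vertex ?ds (length x + j)"]) simp
qed

text \<open>An \<open>L\<close>- or \<open>R\<close>-atom leads from a node to one of its children.
  Both words have the same letters in the contexts: at equal positions on the left, and at positions
  shifted from \<open>length l\<close> to \<open>length r\<close> on the right.\<close>

lemma tree_context_closed: "context_closed Label (tree_model \<Theta> w)"
  unfolding context_closed_def tree_model_atoms
proof (intro conjI allI impI)
  fix a x0 x1 y1
  assume E: "E x0 (Label (letter_code a)) x1 \<in> tree_base \<Theta> w" and L: "L x1 y1 \<in> tree_base \<Theta> w"
  from L obtain ds x l r y i where y: "x1 = Vertex ds i" "y1 = Vertex (ds @ [(x, l, r, y)]) i"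
      "i \<le> length x" "valid \<Theta> w (ds @ [(x, l, r, y)])"
    by (auto elim: tree_base.cases)
  obtain j where j: "x0 = Vertex ds j" "i = Suc j" "letter_code a = letter_code (result w ds ! j)"
    using E y(1) by (auto elim: tree_base.cases)
  have "result w ds = x @ l @ y"
    using y(4) by (simp add: valid_snoc redexes_def)
  then have "result w ds ! j = result w (ds @ [(x, l, r, y)]) ! j"
    using j(2) y(3) by (simp add: nth_append)
  then have "E (Vertex (ds @ [(x, l, r, y)]) j) (Label (letter_code a)) y1 \<in> tree_base \<Theta> w"
    using tree_base.edge[OF y(4), of j] y j by simp
  moreover have "L x0 (Vertex (ds @ [(x, l, r, y)]) j) \<in> tree_base \<Theta> w"
    using tree_base.left[OF y(4), of j] y j by simp
  ultimately show "\<exists>y0. L x0 y0 \<in> tree_base \<Theta> w \<and> E y0 (Label (letter_code a)) y1 \<in> tree_base \<Theta> w"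
    by blast
next
  fix a x0 x1 y0
  assume R: "R x0 y0 \<in> tree_base \<Theta> w" and E: "E x0 (Label (letter_code a)) x1 \<in> tree_base \<Theta> w"
  from R obtain ds x l r y i where y: "x0 = Vertex ds (length x + length l + i)"
      "y0 = Vertex (ds @ [(x, l, r, y)]) (length x + length r + i)"
      "i \<le> length y" "valid \<Theta> w (ds @ [(x, l, r, y)])"
    by (auto elim: tree_base.cases)
  have res: "result w ds = x @ l @ y"
    using y(4) by (simp add: valid_snoc redexes_def)
  have j: "x1 = Vertex ds (length x + length l + Suc i)" "length x + length l + i < length (result w ds)"
      "letter_code a = letter_code (result w ds ! (length x + length l + i))"
    using E y(1) by (auto elim: tree_base.cases)
  \<comment> \<open>The edge leaving \<open>x0\<close> lies inside the word, so its end is still a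
    position of the right context, as the rule \<open>right\<close> demands.\<close>
  have i: "Suc i \<le> length y"
    using j(2) res by simp
  have "result w ds ! (length x + length l + i) = result w (ds @ [(x, l, r, y)]) ! (length x + length r + i)"
    by (simp add: res nth_append)
  then have "E y0 (Label (letter_code a)) (Vertex (ds @ [(x, l, r, y)]) (length x + length r + Suc i))
      \<in> tree_base \<Theta> w"
    using tree_base.edge[OF y(4), of "length x + length r + i"] y(2) j(3) i by simp
  moreover have "R x1 (Vertex (ds @ [(x, l, r, y)]) (length x + length r + Suc i)) \<in> tree_base \<Theta> w"
    using tree_base.right[OF y(4) i] j(1) by simp
  ultimately show "\<exists>y1. E y0 (Label (letter_code a)) y1 \<in> tree_base \<Theta> w \<and> R x1 y1 \<in> tree_base \<Theta> w"
    by blast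
qed

lemma tree_star_closed: "star_closed (tree_model \<Theta> w)"
proof -
  let ?r = "edge_rel (tree_base \<Theta> w)"
  have "(p, q) \<in> ?r" if "E p z q \<in> tree_base \<Theta> w" for p z q
    using that by (auto simp: edge_rel_def)
  moreover have "(p, q) \<in> ?r" if "L p q \<in> tree_base \<Theta> w \<or> R p q \<in> tree_base \<Theta> w" for p q
    using that by (auto simp: edge_rel_def)
  ultimately show ?thesis
    unfolding star_closed_def tree_model_atoms by (meson r_into_trancl trancl_trans)
qed

lemma tree_domain_closed: "domain_closed Label (tree_model \<Theta> w)"
proof -
  let ?V = "\<Union>A \<in> tree_base \<Theta> w. set_atom A"
  have "edge_rel (tree_base \<Theta> w) \<subseteq> ?V \<times> ?V"
    by (force simp: edge_rel_def)
  then have "(edge_rel (tree_base \<Theta> w))\<^sup>+ \<subseteq> ?V \<times> ?V"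
    by (rule trancl_subset_Sigma)
  then show ?thesis
    unfolding domain_closed_def tree_model_atoms by fastforce
qed

text \<open>Lexicographically, \<open>E\<close> raises the position within a node while
  \<open>L\<close> and \<open>R\<close> raise the depth. Labels are never endpoints of such edges,
  so their rank is arbitrary.\<close>

fun node_rank :: "node \<Rightarrow> nat \<times> nat" where
  "node_rank (Label c) = (0, 0)"
| "node_rank (Vertex ds i) = (length ds, i)"

lemma tree_acyclic: "Estar v v \<notin> tree_model \<Theta> w"
proof -
  have "edge_rel (tree_base \<Theta> w) \<subseteq> inv_image (less_than <*lex*> less_than) node_rank"
    by (auto simp: edge_rel_def elim!: tree_base.cases)
  moreover have "acyclic (inv_image (less_than <*lex*> less_than) node_rank)"
    by (intro wf_acyclic wf_inv_image wf_lex_prod wf_less_than)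
  ultimately have "acyclic (edge_rel (tree_base \<Theta> w))"
    by (rule acyclic_subset[rotated])
  then show ?thesis
    by (simp add: tree_model_atoms acyclic_def)
qed

lemma tree_satisfies:
  assumes "word_rewriting_system \<Theta>" "\<xi> \<in> \<Sigma>_of \<Theta>"
  shows "satisfies Label (tree_model \<Theta> w) \<xi>"
  using closed_satisfies_Sigma_of[OF assms(1) tree_rule_closed[OF assms(1)] tree_context_closed
      tree_domain_closed tree_star_closed tree_acyclic assms(2)] .

text \<open>Paths in \<open>M\<close> are chosen by recursion along each derivation. Distinct
  derivations share no vertices, so the choices never clash.\<close>

lemma tree_model_maps_into:
  assumes M: "rule_closed \<kappa> \<Theta> M" "context_closed \<kappa> M" "domain_closed \<kappa> M" "star_closed M"
    and p: "is_path \<kappa> M w p"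
  shows "\<exists>f. maps_into f Label (tree_model \<Theta> w) \<kappa> M"
proof -
  define next_path where
    "next_path p s = (SOME q. is_path \<kappa> M (contract s) q \<and> linked M p s q)" for p s
  \<comment> \<open>The fold makes the path of a child the chosen successor of its parent's path,
    which is exactly what the \<open>L\<close>- and \<open>R\<close>-atoms of the tree
    require.\<close>
  define \<phi> where "\<phi> = foldl next_path p"
  have nxt: "is_path \<kappa> M (contract s) (next_path q s) \<and> linked M q s (next_path q s)"
    if "is_path \<kappa> M u q" "s \<in> redexes \<Theta> u" for u q s
    using someI_ex[OF path_rewrite_step[OF M(1,2) that(2,1)]] unfolding next_path_def .
  have path: "is_path \<kappa> M (result w ds) (\<phi> ds)" if "valid \<Theta> w ds" for ds
    using that
  proof (induction ds rule: rev_induct)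
    case Nil
    then show ?case using p by (simp add: \<phi>_def)
  next
    case (snoc s ds)
    then show ?case
      using nxt[of "result w ds" "\<phi> ds" s] by (simp add: \<phi>_def valid_snoc)
  qed
  have linked: "linked M (\<phi> ds) s (\<phi> (ds @ [s]))" if "valid \<Theta> w (ds @ [s])" for ds s
    using nxt[OF path, of ds s] that by (simp add: \<phi>_def valid_snoc)
  let ?f = "\<lambda>v. case v of Label c \<Rightarrow> \<kappa> c | Vertex ds i \<Rightarrow> \<phi> ds i"
  have "map_atom ?f A \<in> M" if "A \<in> tree_base \<Theta> w" for A
    using that
  proof cases
    case (edge ds i)
    then show ?thesis
      using path[of ds] by (simp add: is_path_def)
  next
    case (left ds x l r y i)
    then show ?thesis
      using linked[of ds "(x, l, r, y)"] by simp
  next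
    case (right ds x l r y i)
    then show ?thesis
      using linked[of ds "(x, l, r, y)"] by simp
  qed
  then have "maps_into ?f Label (tree_base \<Theta> w) \<kappa> M"
    by (auto simp: maps_into_def)
  then have "maps_into ?f Label (tree_model \<Theta> w) \<kappa> M"
    unfolding tree_model_def by (rule saturate_maps_into[OF _ M(4,3)])
  then show ?thesis by (intro exI[of _ ?f])
qed

section \<open>The two directions of the equivalence\<close>

lemma chase_terminates_if_no_infinite_derivation:
  assumes \<Theta>: "word_rewriting_system \<Theta>" and x: "inj_on x {..length w}"
    and chase: "core_chase_sequence (\<Sigma>_of \<Theta>) (word_instance x w) Is"
    and none: "\<nexists>ws. ws 0 = w \<and> infinite_derivation \<Theta> ws"
  shows "chase_terminates (\<Sigma>_of \<Theta>) Is"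
proof (rule ccontr)
  let ?\<Sigma> = "\<Sigma>_of \<Theta>" and ?U = "tree_model \<Theta> w"
  assume "\<not> chase_terminates ?\<Sigma> Is"
  then have active: "active_triggers ?\<Sigma> (Is n) \<noteq> {}" for n
    by (auto simp: chase_terminates_def)
  then have step: "core_chase_step ?\<Sigma> (Is n) (Is (Suc n))" for n
    using chase by (auto simp: core_chase_sequence_def)
  obtain f where hom: "\<And>n. homomorphism (Is n) (Is (Suc n)) (f n)"
    and adv: "\<And>n \<xi> h. \<xi> \<in> ?\<Sigma> \<Longrightarrow> map_atom (trm_eval Const h) ` set (body \<xi>) \<subseteq> Is n \<Longrightarrow>
      \<exists>h'. (\<forall>v \<in> vars (body \<xi>). h' v = f n (h v)) \<and>
        map_atom (trm_eval Const h') ` set (head \<xi>) \<subseteq> Is (Suc n)"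
    using core_chase_step_advances[OF step active] by metis
  have Is0: "Is 0 = word_instance x w"
    using chase by (simp add: core_chase_sequence_def)
  have "satisfies limit_const (limit f Is) \<xi>" if "\<xi> \<in> ?\<Sigma>" for \<xi>
    using limit_satisfies[of Is f \<xi>, OF hom adv[OF that]] .
  note limit = satisfies_Sigma_of_closed[OF \<Theta> this]
  have fin: "finite \<Theta>"
    using \<Theta> by (simp add: word_rewriting_system_def)
  have "finite ?U"
    unfolding tree_model_def
    by (intro finite_saturate finite_tree_base finite_valid fin none)
  moreover obtain g where "maps_into g Label ?U limit_const (limit f Is)"
    using tree_model_maps_into[OF limit word_instance_is_path] limit_stage_0[of Is f, OF hom] Is0 by metis
  \<comment> \<open>Stage 0 is the given instance, and only later stages arise as cores; hence the
    bound on \<open>N\<close>.\<close>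
  ultimately obtain N h where "N \<ge> Suc 0" and h: "maps_into h Label ?U Const (Is N)"
    using maps_into_limit_stage[of Is f, OF hom] by blast
  then obtain J where core: "is_core J (Is N)"
    using step by (metis core_chase_step_def Suc_le_D)
  have "is_path Label ?U w (Vertex [])"
    using tree_base.edge[of \<Theta> w "[]"] by (simp add: is_path_def tree_model_atoms)
  then obtain g where g: "maps_into g Const (Is N) Label ?U"
    using is_path_word_instance[OF x] core_chase_sequence_maps_into[OF tree_satisfies[OF \<Theta>] chase]
    by blast
  have "finite (Is N)"
    using fin by (intro core_chase_sequence_finite[OF _ _ chase])
      (auto simp: \<Sigma>_of_def context_tgds_def domain_tgds_def closure_tgds_def loop_tgds_def
        word_instance_def Let_def)
  then have "satisfies Const (Is N) \<xi>" if "\<xi> \<in> ?\<Sigma>" for \<xi>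
    using core_equivalent_model_satisfies[OF _ core_endomorphism_surj[OF core] g h tree_satisfies[OF \<Theta> that]]
    by blast
  then show False
    using active no_active_triggers_iff by blast
qed

theorem theorem16:
  fixes \<Theta> :: "(word \<times> word) set" and w :: word
    and x :: "nat \<Rightarrow> nat" and Is :: "nat \<Rightarrow> val atom set"
  assumes "word_rewriting_system \<Theta>"
    and "inj_on x {..length w}"
    and "core_chase_sequence (\<Sigma>_of \<Theta>) (word_instance x w) Is"
  shows "chase_infinite (\<Sigma>_of \<Theta>) Is \<longleftrightarrow>
    (\<exists>ws. ws 0 = w \<and> infinite_derivation \<Theta> ws)"
proof
  assume "chase_infinite (\<Sigma>_of \<Theta>) Is"
  then show "\<exists>ws. ws 0 = w \<and> infinite_derivation \<Theta> ws"
    using chase_terminates_if_no_infinite_derivation[OF assms] by blast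
next
  assume "\<exists>ws. ws 0 = w \<and> infinite_derivation \<Theta> ws"
  then obtain ws where ws: "ws 0 = w" "infinite_derivation \<Theta> ws"
    by blast
  have "active_triggers (\<Sigma>_of \<Theta>) (Is n) \<noteq> {}" for n
  proof
    assume "active_triggers (\<Sigma>_of \<Theta>) (Is n) = {}"
    then have "satisfies Const (Is n) \<xi>" if "\<xi> \<in> \<Sigma>_of \<Theta>" for \<xi>
      using that no_active_triggers_iff by blast
    note closed = satisfies_Sigma_of_closed[OF assms(1) this]
    obtain f where "maps_into f Const (word_instance x w) Const (Is n)"
      using core_chase_sequence_homomorphism[OF assms(3)] homomorphism_maps_into by blast
    then have path: "is_path Const (Is n) (ws 0) (\<lambda>i. f (Null (x i)))"
      unfolding ws(1) by (rule word_instance_is_path)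
    have "finite (Is n)"
      using assms(1) by (intro core_chase_sequence_finite[OF _ _ assms(3)])
        (auto simp: word_rewriting_system_def \<Sigma>_of_def context_tgds_def domain_tgds_def
          closure_tgds_def loop_tgds_def word_instance_def Let_def)
    then show False
      using infinite_derivation_cycle[OF _ closed(1,2,4) path ws(2)]
        core_chase_sequence_acyclic[OF assms] by blast
  qed
  then show "chase_infinite (\<Sigma>_of \<Theta>) Is"
    by (simp add: chase_terminates_def)
qed

end
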